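(* Let $f$ satisfy the Standing Assumption in the context, let $m_0\in\mathbb{R}^D$, let $C_0\in\mathbb{R}^{D\times D}$ be positive semi-definite, and for $\Delta t>0$ define $m_{k+1}=m_k+f(m_k)\Delta t$, $k\ge 0$. For $\epsilon>0$ let $\mu_{0:k}^\epsilon$ be the law in $\mathbb{R}^{D(k+1)}$ of $(v_j^\epsilon)_{j=0}^k$ given by $$v_{k+1}^\epsilon=v_k^\epsilon+f(v_k^\epsilon)\Delta t+\sqrt{\epsilon\Sigma\Delta t}\,\xi_k,\qquad v_0^\epsilon\sim\mu_0^\epsilon,$$ and let $\nu_{0:k}^\epsilon$ be the law in $\mathbb{R}^{D(k+1)}$ of $(l_j^\epsilon)_{j=0}^k$ given by $$l_{k+1}^\epsilon=l_k^\epsilon+\bigl(f(m_k)+Df(m_k)(l_k^\epsilon-m_k)\bigr)\Delta t+\sqrt{\epsilon\Sigma\Delta t}\,\xi_k,\qquad l_0^\epsilon\sim\nu_0^\epsilon=N(m_0,\epsilon C_0).$$ Then, for all sufficiently small (fixed) $\Delta t>0$, there is a constant $c>0$ independent of the noise strength $\epsilon$ such that, for all sufficiently small $\epsilon>0$ and for all integers $k\ge 0$ with $k\Delta t<T$, $$D_{\mathrm{KL}}(\nu_{0:k}^\epsilon\|\mu_{0:k}^\epsilon)\le D_{\mathrm{KL}}(\nu_0^\epsilon\|\mu_0^\epsilon)+c\,\epsilon,\qquad D_{\mathrm{KL}}(\nu_k^\epsilon\|\mu_k^\epsilon)\le D_{\mathrm{KL}}(\nu_0^\epsilon\|\mu_0^\epsilon)+c\,\epsilon,$$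 where $\mu_k^\epsilon$ and $\nu_k^\epsilon$ are the laws of $v_k^\epsilon$ and $l_k^\epsilon$ in $\mathbb{R}^D$.
   Context: $T>0$ is finite and fixed; $D\in\mathbb{N}$; $\Sigma\in\mathbb{R}^{D\times D}$ is a fixed (symmetric) positive-definite matrix; the $\xi_k$ are independent standard Gaussian random vectors in $\mathbb{R}^D$, independent of the initial condition; $\mu_0^\epsilon$ is a probability measure on $\mathbb{R}^D$ for each $\epsilon>0$. The step-size $\Delta t$ is small and fixed, and small $\epsilon$ is considered. Standing Assumption: $f\in C^2(\mathbb{R}^D,\mathbb{R}^D)$ and there exist a constant $c>0$ and $s\in\mathbb{N}$ such that, for $1\le d\le D$ and every multi-index $\alpha$ with $|\alpha|=2$, $|\partial^\alpha f_d(u)|\le c(1+|u|^s)$ for all $u\in\mathbb{R}^D$. Moreover, for any $m_0\in\mathbb{R}^D$, the ODE $\frac{dm}{dt}=f(m)$, $t\in[0,T]$, $m(0)=m_0$, has a unique solution on $[0,T]$. $Df$ denotes the Jacobian of $f$. One has $\nu_k^\epsilon=N(m_k,\epsilon C_k)$, where $C_{k+1}=\bigl(I+Df(m_k)\Delta t\bigr)C_k\bigl(I+Df(m_k)\Delta t\bigr)^T+\Sigma\Delta t$. The Kullback-Leibler divergence is $D_{\mathrm{KL}}(\nu\|\mu)=\mathbb{E}^\nu\log\frac{d\nu}{d\mu}$ if $\nu\ll\mu$, and $+\infty$ otherwise. $N(m_0,\epsilon C_0)$ is the Dirac measure at $m_0$ if $C_0=0$. *)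

theory Defs
  imports "HOL-Probability.Probability"
begin

definition pos_semidef :: "real ^ 'n ^ 'n \<Rightarrow> bool" where
  "pos_semidef A \<longleftrightarrow> transpose A = A \<and> (\<forall>x. 0 \<le> x \<bullet> (A *v x))"

definition pos_def :: "real ^ 'n ^ 'n \<Rightarrow> bool" where
  "pos_def A \<longleftrightarrow> transpose A = A \<and> (\<forall>x. x \<noteq> 0 \<longrightarrow> 0 < x \<bullet> (A *v x))"

(* The positive semi-definite square root.  It exists and is unique for every positive
   semi-definite A, the only case of interest; so the choice is immaterial. *)
definition matrix_sqrt :: "real ^ 'n ^ 'n \<Rightarrow> real ^ 'n ^ 'n" where
  "matrix_sqrt A = (SOME R. pos_semidef R \<and> R ** R = A)"

definition std_gaussian :: "(real ^ 'n) measure" where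
  "std_gaussian = density lborel (\<lambda>x. ennreal (\<Prod>i\<in>UNIV. std_normal_density (x $ i)))"

(* N(m, C).  A pushforward rather than a density, so that C may be singular; for C = 0 this is
   the Dirac measure at m. *)
definition gaussian :: "real ^ 'n \<Rightarrow> real ^ 'n ^ 'n \<Rightarrow> (real ^ 'n) measure" where
  "gaussian m C = distr std_gaussian borel (\<lambda>x. m + matrix_sqrt C *v x)"

(* Argument order as in D(nu || mu); natural logarithm.  The library's KL_divergence is
   real-valued and 0 when the log-density is not integrable.  Here the expectation of
   log(d nu / d mu) under nu is the extended one, positive part minus negative part
   (ennreal truncates negative reals to 0); the negative part is finite for probability
   measures. *)
definition KL :: "'a measure \<Rightarrow> 'a measure \<Rightarrow> ereal" where
  "KL \<nu> \<mu> =
    (if absolutely_continuous \<mu> \<nu>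
     then enn2ereal (\<integral>\<^sup>+ x. ennreal (entropy_density (exp 1) \<mu> \<nu> x) \<partial>\<nu>)
        - enn2ereal (\<integral>\<^sup>+ x. ennreal (- entropy_density (exp 1) \<mu> \<nu> x) \<partial>\<nu>)
     else \<infinity>)"

definition C2 :: "('a::real_normed_vector \<Rightarrow> 'b::real_normed_vector) \<Rightarrow> bool" where
  "C2 f \<longleftrightarrow> (\<exists>(f' :: 'a \<Rightarrow> 'a \<Rightarrow>\<^sub>L 'b) (f'' :: 'a \<Rightarrow> 'a \<Rightarrow>\<^sub>L ('a \<Rightarrow>\<^sub>L 'b)).
     (\<forall>x. (f has_derivative blinfun_apply (f' x)) (at x)) \<and>
     (\<forall>x. (f' has_derivative blinfun_apply (f'' x)) (at x)) \<and>
     continuous_on UNIV f'')"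

definition partial_deriv :: "'n::finite \<Rightarrow> (real ^ 'n \<Rightarrow> real) \<Rightarrow> real ^ 'n \<Rightarrow> real" where
  "partial_deriv i g x = deriv (\<lambda>t. g (x + t *\<^sub>R axis i 1)) 0"

definition ode_solution ::
    "(real ^ 'n \<Rightarrow> real ^ 'n) \<Rightarrow> real \<Rightarrow> real ^ 'n \<Rightarrow> (real \<Rightarrow> real ^ 'n) \<Rightarrow> bool" where
  "ode_solution f T x0 m \<longleftrightarrow>
     m 0 = x0 \<and> (\<forall>t\<in>{0..T}. (m has_vector_derivative f (m t)) (at t within {0..T}))"

(* The multi-indices of order 2 are e_i + e_j.  Uniqueness of an ODE solution can only refer to
   its values on [0, T], since functions are total. *)
definition standing_assumption :: "(real ^ 'n \<Rightarrow> real ^ 'n) \<Rightarrow> real \<Rightarrow> bool" where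
  "standing_assumption f T \<longleftrightarrow>
     C2 f \<and>
     (\<exists>c>0. \<exists>s::nat. \<forall>d i j u.
        \<bar>partial_deriv i (partial_deriv j (\<lambda>x. f x $ d)) u\<bar> \<le> c * (1 + norm u ^ s)) \<and>
     (\<forall>x0. (\<exists>m. ode_solution f T x0 m) \<and>
        (\<forall>m m'. ode_solution f T x0 m \<longrightarrow> ode_solution f T x0 m' \<longrightarrow> (\<forall>t\<in>{0..T}. m t = m' t)))"

(* In the recursions below, h is the time step \<Delta>t and S the noise covariance \<Sigma>. *)

primrec euler_mean :: "(real ^ 'n \<Rightarrow> real ^ 'n) \<Rightarrow> real \<Rightarrow> real ^ 'n \<Rightarrow> nat \<Rightarrow> real ^ 'n" where
  "euler_mean f h m0 0 = m0"
| "euler_mean f h m0 (Suc k) = euler_mean f h m0 k + h *\<^sub>R f (euler_mean f h m0 k)"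

primrec nonlinear_chain ::
    "(real ^ 'n \<Rightarrow> real ^ 'n) \<Rightarrow> real ^ 'n ^ 'n \<Rightarrow> real \<Rightarrow> real
      \<Rightarrow> (nat \<Rightarrow> 'w \<Rightarrow> real ^ 'n) \<Rightarrow> ('w \<Rightarrow> real ^ 'n) \<Rightarrow> nat \<Rightarrow> 'w \<Rightarrow> real ^ 'n" where
  "nonlinear_chain f S \<epsilon> h \<xi> v0 0 = v0"
| "nonlinear_chain f S \<epsilon> h \<xi> v0 (Suc k) = (\<lambda>\<omega>.
     let v = nonlinear_chain f S \<epsilon> h \<xi> v0 k \<omega>
     in v + h *\<^sub>R f v + matrix_sqrt ((\<epsilon> * h) *\<^sub>R S) *v \<xi> k \<omega>)"

primrec linearized_chain ::
    "(real ^ 'n \<Rightarrow> real ^ 'n) \<Rightarrow> real ^ 'n ^ 'n \<Rightarrow> real \<Rightarrow> real \<Rightarrow> real ^ 'n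
      \<Rightarrow> (nat \<Rightarrow> 'w \<Rightarrow> real ^ 'n) \<Rightarrow> ('w \<Rightarrow> real ^ 'n) \<Rightarrow> nat \<Rightarrow> 'w \<Rightarrow> real ^ 'n" where
  "linearized_chain f S \<epsilon> h m0 \<xi> l0 0 = l0"
| "linearized_chain f S \<epsilon> h m0 \<xi> l0 (Suc k) = (\<lambda>\<omega>.
     let l = linearized_chain f S \<epsilon> h m0 \<xi> l0 k \<omega>; m = euler_mean f h m0 k
     in l + h *\<^sub>R (f m + jacobian f (at m) *v (l - m)) + matrix_sqrt ((\<epsilon> * h) *\<^sub>R S) *v \<xi> k \<omega>)"

(* The law of (X_0, ..., X_k); R^(D(k+1)) appears as the (k+1)-fold product of R^D, whose points
   are functions on {..k}. *)
definition path_law :: "'w measure \<Rightarrow> (nat \<Rightarrow> 'w \<Rightarrow> real ^ 'n) \<Rightarrow> nat \<Rightarrow> (nat \<Rightarrow> real ^ 'n) measure" where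
  "path_law M X k = distr M (\<Pi>\<^sub>M j\<in>{..k}. borel) (\<lambda>\<omega>. \<lambda>j\<in>{..k}. X j \<omega>)"

end

theory Submission
  imports Defs
begin

text \<open>
  Both chains are driven by the same Gaussian noise, so one step of the pair costs at most
  \<open>E |\<theta>|\<^sup>2 / 2\<close> in relative entropy, where \<open>\<theta>\<close> is the shift of the noise that turns the nonlinear
  drift into the linearized one. This follows from the variational formula for the relative
  entropy and a Gaussian shift, with no path density; the variational formula also makes the passage to the
  marginals immediate. By Taylor's formula the drifts differ by \<open>O(|l - m|\<^sup>2 (1 + |l - m|\<^sup>s))\<close>, the
  moments of \<open>l - m\<close> of order \<open>p\<close> are \<open>O(\<epsilon>\<^sup>p\<^sup>/\<^sup>2)\<close>, and \<open>|\<theta>|\<^sup>2\<close> is \<open>O(1/\<epsilon>)\<close> times the squared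
  difference, so each step costs \<open>O(\<epsilon>)\<close>; for fixed \<open>\<Delta>t\<close> there are at most \<open>T / \<Delta>t + 1\<close> steps.
\<close>

section \<open>Relative entropy\<close>

text \<open>The obstacle is that \<open>C0\<close> may be singular and the initial laws
  \<open>\<mu>0 \<epsilon>\<close> are arbitrary, so the path laws have in general no Lebesgue
  densities to divide. Test functions avoid this: a test function of the pair (state, next state) is
  integrated over the noise first, and the logarithm of the resulting exponential integral is again
  a bounded test function of the state. This plays the part of the chain rule, without kernels or
  conditional densities. The inequality \<open>E_Q \<phi> + 1 \<le> E_P (exp \<phi>) + B\<close> is
  linear in the P-integral, so iterated integrals can be substituted in it directly; a logarithm
  appears only in the noise integral for a fixed state, where Jensen's inequality yields it.
  Constants are chosen for each step index before \<open>\<epsilon>\<close>; as only finitely many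
  steps occur, they need not be uniform in the index. Since \<open>matrix_sqrt\<close> is a choice
  operator, the existence of square roots is established separately.\<close>

text \<open>
  Boundedness of the relative entropy in the form
  \<open>KL Q P = sup (E\<^sub>Q \<phi> - E\<^sub>P (exp \<phi> - 1))\<close>, the supremum being over bounded test functions
  \<open>\<phi>\<close>; it comes from the Legendre transform of \<open>t ln t - t + 1\<close>.
\<close>

definition relative_entropy_le :: "'a measure \<Rightarrow> 'a measure \<Rightarrow> real \<Rightarrow> bool" where
  "relative_entropy_le Q P B \<longleftrightarrow> (\<forall>\<phi>\<in>borel_measurable P. \<forall>c. (\<forall>x. \<bar>\<phi> x\<bar> \<le> c) \<longrightarrow>
     (\<integral>x. \<phi> x \<partial>Q) + 1 \<le> (\<integral>x. exp (\<phi> x) \<partial>P) + B)"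

lemma relative_entropy_leD:
  assumes "relative_entropy_le Q P B" "\<phi> \<in> borel_measurable P" "\<And>x. \<bar>\<phi> x\<bar> \<le> c"
  shows "(\<integral>x. \<phi> x \<partial>Q) + 1 \<le> (\<integral>x. exp (\<phi> x) \<partial>P) + B"
  using assms unfolding relative_entropy_le_def by blast

lemma relative_entropy_le_mono: "relative_entropy_le Q P B \<Longrightarrow> B \<le> B' \<Longrightarrow> relative_entropy_le Q P B'"
  unfolding relative_entropy_le_def by (meson add_left_mono order_trans)

section \<open>Densities, and duality between the divergence and bounded test functions\<close>

lemma integrable_bounded_prob:
  fixes \<phi> :: "'a \<Rightarrow> real"
  assumes "prob_space P" "\<phi> \<in> borel_measurable P" "\<And>x. \<bar>\<phi> x\<bar> \<le> c"
  shows "integrable P \<phi>" "integrable P (\<lambda>x. exp (\<phi> x))"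
proof -
  interpret prob_space P by fact
  show "integrable P \<phi>"
    using assms by (intro integrable_const_bound[where B = c]) auto
  have "exp (\<phi> x) \<le> exp c" for x
    using assms(3)[of x] by simp
  then show "integrable P (\<lambda>x. exp (\<phi> x))"
    using assms by (intro integrable_const_bound[where B = "exp c"]) auto
qed

text \<open>The derivative is finite P-almost everywhere, so \<open>enn2real\<close> loses nothing.
  Positivity can hold only Q-almost everywhere: Q gives no mass to the zeros of \<open>g\<close>, P
  may.\<close>

lemma RN_density_real:
  assumes P: "prob_space P" and Q: "prob_space Q" and sets: "sets Q = sets P"
    and ac: "absolutely_continuous P Q"
  obtains g where "g \<in> borel_measurable P" "\<And>x. 0 \<le> g x" "Q = density P (\<lambda>x. ennreal (g x))"
    "integrable P g" "(\<integral>x. g x \<partial>P) = 1" "AE x in Q. 0 < g x"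
    "entropy_density (exp 1) P Q = (\<lambda>x. ln (g x))"
proof
  define g where "g = (\<lambda>x. enn2real (RN_deriv P Q x))"
  interpret P: prob_space P by fact
  interpret Q: prob_space Q by fact
  show [measurable]: "g \<in> borel_measurable P" unfolding g_def by simp
  show g0: "\<And>x. 0 \<le> g x" by (simp add: g_def)
  have D: "Q = density P (RN_deriv P Q)"
    using P.density_RN_deriv[OF ac] sets by simp
  have "AE x in P. RN_deriv P Q x \<noteq> \<infinity>"
    using P.RN_deriv_finite[OF Q.sigma_finite_measure_axioms ac] sets by simp
  then have ae: "AE x in P. RN_deriv P Q x = ennreal (g x)"
    by eventually_elim (simp add: g_def less_top)
  show D': "Q = density P (\<lambda>x. ennreal (g x))"
    by (subst D, intro density_cong ae) auto
  have "(\<integral>\<^sup>+x. ennreal (g x) \<partial>P) = emeasure Q (space Q)"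
    unfolding D' by (simp add: emeasure_density cong: nn_integral_cong)
  then have 1: "(\<integral>\<^sup>+x. ennreal (g x) \<partial>P) = ennreal 1" using Q.emeasure_space_1 by simp
  from nn_integral_eq_integrable[THEN iffD1, OF _ _ _ 1] g0
  show "integrable P g" "(\<integral>x. g x \<partial>P) = 1" by auto
  show "AE x in Q. 0 < g x"
    by (subst D') (auto simp: AE_density g0)
  show "entropy_density (exp 1) P Q = (\<lambda>x. ln (g x))"
    by (simp add: entropy_density_def g_def comp_def log_def)
qed

lemma xlogx_lower: "0 \<le> t \<Longrightarrow> t * max 0 (- ln t) \<le> (1::real)"
proof (cases "t = 0")
  case False
  assume "0 \<le> t"
  then have "t > 0" using False by simp
  then have "- ln t \<le> inverse t"
    using ln_le_minus_one[of "inverse t"] by (simp add: ln_inverse)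
  then show ?thesis using \<open>t > 0\<close> by (auto simp: max_def field_simps)
qed simp

text \<open>Under P the integrand becomes the negative part of \<open>g ln g\<close>, which is
  bounded by 1. Hence the difference defining \<open>KL\<close> is never infinity minus
  infinity.\<close>

lemma KL_neg_part_le:
  assumes P: "prob_space P" and Q: "prob_space Q" and sets: "sets Q = sets P"
    and ac: "absolutely_continuous P Q"
  shows "(\<integral>\<^sup>+ x. ennreal (- entropy_density (exp 1) P Q x) \<partial>Q) \<le> 1"
proof -
  interpret P: prob_space P by fact
  obtain g where g: "g \<in> borel_measurable P" "\<And>x. 0 \<le> g x" "Q = density P (\<lambda>x. ennreal (g x))"
    "integrable P g" "(\<integral>x. g x \<partial>P) = 1" "AE x in Q. 0 < g x"
    and ent: "entropy_density (exp 1) P Q = (\<lambda>x. ln (g x))"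
    by (rule RN_density_real[OF P Q sets ac]) blast
  have [measurable]: "g \<in> borel_measurable P" by fact
  have "(\<integral>\<^sup>+ x. ennreal (- ln (g x)) \<partial>Q) = (\<integral>\<^sup>+ x. ennreal (g x * max 0 (- ln (g x))) \<partial>P)"
    by (subst g(3), subst nn_integral_density)
      (auto simp: ennreal_mult g(2) max_def ennreal_neg intro!: nn_integral_cong)
  also have "\<dots> \<le> (\<integral>\<^sup>+ x. 1 \<partial>P)"
    using xlogx_lower[OF g(2)] by (intro nn_integral_mono) (auto simp: ennreal_le_1)
  also have "\<dots> = 1" by (simp add: P.emeasure_space_1)
  finally show ?thesis unfolding ent .
qed

text \<open>The easy half of the duality: Young's inequality for the conjugate pair
  \<open>t ln t - t\<close> and \<open>exp\<close>, applied pointwise and integrated against P. A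
  real bound on \<open>KL\<close> forces absolute continuity and makes both parts of the log-density
  integrable.\<close>

lemma relative_entropy_le_of_KL_le:
  assumes P: "prob_space P" and Q: "prob_space Q" and sets: "sets Q = sets P"
    and KL: "KL Q P \<le> ereal B"
  shows "relative_entropy_le Q P B"
  unfolding relative_entropy_le_def
proof safe
  fix \<phi> :: "'a \<Rightarrow> real" and c
  assume \<phi>[measurable]: "\<phi> \<in> borel_measurable P" and c: "\<forall>x. \<bar>\<phi> x\<bar> \<le> c"
  interpret P: prob_space P by fact
  interpret Q: prob_space Q by fact
  from KL have ac: "absolutely_continuous P Q" by (auto simp: KL_def split: if_splits)
  obtain g where g: "g \<in> borel_measurable P" "\<And>x. 0 \<le> g x" "Q = density P (\<lambda>x. ennreal (g x))"
    "integrable P g" "(\<integral>x. g x \<partial>P) = 1" "AE x in Q. 0 < g x"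
    and ent: "entropy_density (exp 1) P Q = (\<lambda>x. ln (g x))"
    by (rule RN_density_real[OF P Q sets ac]) blast
  have [measurable]: "g \<in> borel_measurable P" by fact
  have [measurable]: "g \<in> borel_measurable Q" "\<phi> \<in> borel_measurable Q"
    by (simp_all add: measurable_cong_sets[OF sets refl])
  let ?p = "\<integral>\<^sup>+ x. ennreal (ln (g x)) \<partial>Q" and ?n = "\<integral>\<^sup>+ x. ennreal (- ln (g x)) \<partial>Q"
  have n: "?n \<le> 1" using KL_neg_part_le[OF P Q sets ac] unfolding ent .
  have KL': "enn2ereal ?p - enn2ereal ?n \<le> ereal B" using KL ac by (simp add: KL_def ent)
  have nfin: "?n < \<infinity>" using n by (metis ennreal_one_less_top infinity_ennreal_def order.strict_trans1)
  have pfin: "?p < \<infinity>"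
  proof (rule ccontr)
    assume "\<not> ?p < \<infinity>"
    then have "?p = \<infinity>" by (simp add: less_top[symmetric])
    then have "enn2ereal ?p = \<infinity>" by simp
    moreover have "enn2ereal ?n \<noteq> \<infinity>" using nfin by (auto simp: enn2ereal_eq_top_iff)
    ultimately show False using KL' by (cases "enn2ereal ?n") auto
  qed
  have int: "integrable Q (\<lambda>x. ln (g x))"
    unfolding real_integrable_def by (intro conjI less_imp_neq[OF pfin] less_imp_neq[OF nfin]) measurable
  obtain a where a: "?p = ennreal a" "0 \<le> a" using pfin by (cases ?p) auto
  obtain b where b: "?n = ennreal b" "0 \<le> b" using nfin by (cases ?n) auto
  have "(\<integral>x. ln (g x) \<partial>Q) = a - b"
    unfolding real_lebesgue_integral_def[OF int] a(1) b(1) using a(2) b(2) by simp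
  moreover have "a - b \<le> B"
    using KL' unfolding a(1) b(1) using a(2) b(2) by (simp add: enn2ereal_ennreal)
  moreover have "(\<integral>x. \<phi> x \<partial>Q) + 1 - (\<integral>x. exp (\<phi> x) \<partial>P) \<le> (\<integral>x. ln (g x) \<partial>Q)"
  proof -
    have i1: "integrable Q \<phi>" "integrable P (\<lambda>x. exp (\<phi> x))"
      by (rule integrable_bounded_prob[OF Q, of _ c] integrable_bounded_prob[OF P, of _ c]; use c in simp)+
    have i2: "integrable P (\<lambda>x. g x * \<phi> x)"
      using i1(1) unfolding g(3) by (subst (asm) integrable_density) (simp_all add: g(2))
    have i3: "integrable P (\<lambda>x. g x * ln (g x))"
      using int unfolding g(3) by (subst (asm) integrable_density) (simp_all add: g(2))
    have "(\<integral>x. \<phi> x \<partial>Q) = (\<integral>x. g x * \<phi> x \<partial>P)"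
      by (subst g(3), subst integral_density) (auto simp: g(2))
    moreover have "(\<integral>x. ln (g x) \<partial>Q) = (\<integral>x. g x * ln (g x) \<partial>P)"
      by (subst g(3), subst integral_density) (auto simp: g(2))
    moreover have "(\<integral>x. g x * \<phi> x + g x - exp (\<phi> x) \<partial>P) \<le> (\<integral>x. g x * ln (g x) \<partial>P)"
    proof (rule integral_mono)
      show "integrable P (\<lambda>x. g x * \<phi> x + g x - exp (\<phi> x))"
        using i1 i2 g(4) by auto
      show "integrable P (\<lambda>x. g x * ln (g x))" by fact
      fix x
      show "g x * \<phi> x + g x - exp (\<phi> x) \<le> g x * ln (g x)"
      \<comment> \<open>For \<open>g x > 0\<close> this is \<open>ln s \<le> s - 1\<close> at
        \<open>s = exp (\<phi> x) / g x\<close>; for \<open>g x = 0\<close> the left side is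
        \<open>- exp (\<phi> x)\<close> and the right side is 0.\<close>
      proof (cases "g x = 0")
        case False
        then have pos: "g x > 0" using g(2)[of x] by simp
        then have "ln (exp (\<phi> x) / g x) \<le> exp (\<phi> x) / g x - 1"
          by (intro ln_le_minus_one) auto
        then have "\<phi> x - ln (g x) \<le> exp (\<phi> x) / g x - 1" using pos by (simp add: ln_div)
        then have "g x * (\<phi> x - ln (g x)) \<le> g x * (exp (\<phi> x) / g x - 1)"
          using pos by (intro mult_left_mono) auto
        then show ?thesis using pos by (simp add: algebra_simps)
      qed auto
    qed
    moreover have "(\<integral>x. g x * \<phi> x + g x - exp (\<phi> x) \<partial>P)
        = (\<integral>x. g x * \<phi> x \<partial>P) + 1 - (\<integral>x. exp (\<phi> x) \<partial>P)"
      using i1 i2 g(4,5) by simp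
    ultimately show ?thesis by simp
  qed
  ultimately show "(\<integral>x. \<phi> x \<partial>Q) + 1 \<le> (\<integral>x. exp (\<phi> x) \<partial>P) + B" by linarith
qed

text \<open>The test function 0 already forces \<open>B \<ge> 0\<close>. In the theorem this rules
  out the value minus infinity for the initial divergence.\<close>

lemma KL_nonneg:
  assumes P: "prob_space P" and Q: "prob_space Q" and sets: "sets Q = sets P"
  shows "0 \<le> KL Q P"
proof (rule ccontr)
  assume "\<not> 0 \<le> KL Q P"
  \<comment> \<open>The test-function bound takes a real number, so a real value is inserted between
    a possibly infinite \<open>KL\<close> and 0.\<close>
  then obtain B where B: "KL Q P \<le> ereal B" "B < 0"
    by (metis ereal_dense2 ereal_less(2) less_le_not_le linorder_not_le order_less_imp_le less_ereal.simps(1) zero_ereal_def)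
  have "relative_entropy_le Q P B" using relative_entropy_le_of_KL_le[OF P Q sets B(1)] .
  then have "(\<integral>x. 0 \<partial>Q) + 1 \<le> (\<integral>x. exp (0::real) \<partial>P) + B"
    by (rule relative_entropy_leD[of _ _ _ _ 0]) auto
  then show False using B(2) prob_space.prob_space[OF P] by simp
qed

text \<open>Testing with \<open>n\<close> times the indicator of a P-null set leaves the P-integral
  at 1, while the Q-integral is \<open>n\<close> times the Q-mass. Boundedness in \<open>n\<close>
  forces that mass to vanish.\<close>

lemma absolutely_continuous_of_relative_entropy_le:
  assumes P: "prob_space P" and Q: "prob_space Q" and sets: "sets Q = sets P"
    and le: "relative_entropy_le Q P B"
  shows "absolutely_continuous P Q"
  unfolding absolutely_continuous_def
proof
  fix A assume A: "A \<in> null_sets P"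
  interpret P: prob_space P by fact
  interpret Q: prob_space Q by fact
  have [measurable]: "A \<in> sets P" "A \<in> sets Q" using A sets by auto
  have "real n * measure Q A \<le> B" for n :: nat
  proof -
    let ?\<phi> = "\<lambda>x. real n * indicator A x"
    have "(\<integral>x. ?\<phi> x \<partial>Q) + 1 \<le> (\<integral>x. exp (?\<phi> x) \<partial>P) + B"
      by (rule relative_entropy_leD[OF le, of _ "real n"]) (auto simp: indicator_def)
    moreover have "AE x in P. exp (?\<phi> x) = 1"
      using AE_not_in[OF A] by eventually_elim simp
    then have "(\<integral>x. exp (?\<phi> x) \<partial>P) = (\<integral>x. 1 \<partial>P)"
      by (intro integral_cong_AE) auto
    ultimately show ?thesis by (simp add: P.prob_space)
  qed
  then have "measure Q A = 0"
    using reals_Archimedean3[of "measure Q A"] by (metis linorder_not_less measure_nonneg order_le_less)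
  then show "A \<in> null_sets Q" by (auto simp: null_sets_def Q.emeasure_eq_measure)
qed

text \<open>The optimal test function is \<open>ln g\<close>, which is unbounded. Truncating it to
  the range from -n to n raises the P-integral by at most \<open>exp (- n)\<close>, an error that
  disappears in the limit.\<close>

lemma KL_le_of_relative_entropy_le:
  assumes P: "prob_space P" and Q: "prob_space Q" and sets: "sets Q = sets P"
    and le: "relative_entropy_le Q P B"
  shows "KL Q P \<le> ereal B"
proof -
  interpret P: prob_space P by fact
  interpret Q: prob_space Q by fact
  have ac: "absolutely_continuous P Q"
    using absolutely_continuous_of_relative_entropy_le[OF P Q sets le] .
  obtain g where g: "g \<in> borel_measurable P" "\<And>x. 0 \<le> g x" "Q = density P (\<lambda>x. ennreal (g x))"
    "integrable P g" "(\<integral>x. g x \<partial>P) = 1" "AE x in Q. 0 < g x"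
    and ent: "entropy_density (exp 1) P Q = (\<lambda>x. ln (g x))"
    by (rule RN_density_real[OF P Q sets ac]) blast
  have [measurable]: "g \<in> borel_measurable P" by fact
  have [measurable]: "g \<in> borel_measurable Q"
    by (simp_all add: measurable_cong_sets[OF sets refl])
  let ?p = "\<integral>\<^sup>+ x. ennreal (ln (g x)) \<partial>Q" and ?n = "\<integral>\<^sup>+ x. ennreal (- ln (g x)) \<partial>Q"
  have n: "?n \<le> 1" using KL_neg_part_le[OF P Q sets ac] unfolding ent .
  define N where "N = enn2real ?n"
  have N: "?n = ennreal N" "0 \<le> N"
    using le_less_trans[OF n ennreal_one_less_top] unfolding N_def by (simp_all add: ennreal_enn2real)
  \<comment> \<open>The two parts are truncated separately because \<open>KL\<close> integrates them
    separately. The negative one is controlled by \<open>N\<close> for every \<open>n\<close>, so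
    only the positive one needs a limit.\<close>
  define tp where "tp = (\<lambda>(n::nat) x. min (real n) (max 0 (ln (g x))))"
  define tn where "tn = (\<lambda>(n::nat) x. min (real n) (max 0 (- ln (g x))))"
  have [measurable]: "tp n \<in> borel_measurable Q" "tn n \<in> borel_measurable Q" for n
    unfolding tp_def tn_def by simp_all
  have tb: "0 \<le> tp n x" "tp n x \<le> n" "0 \<le> tn n x" "tn n x \<le> n" for n x
    by (auto simp: tp_def tn_def)
  have tint: "integrable Q (tp n)" "integrable Q (tn n)" for n
    by (rule integrable_bounded_prob[OF Q, of _ "real n"]; use tb[of n] in simp)+
  have tnN: "(\<integral>x. tn n x \<partial>Q) \<le> N" for n
  proof -
    have "ennreal (\<integral>x. tn n x \<partial>Q) = (\<integral>\<^sup>+x. ennreal (tn n x) \<partial>Q)"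
      using tint tb by (simp add: nn_integral_eq_integral)
    also have "\<dots> \<le> ?n" by (intro nn_integral_mono) (auto simp: tn_def max_def min_def ennreal_neg intro!: ennreal_leI)
    finally show ?thesis using N by simp
  qed
  have step: "(\<integral>x. tp n x \<partial>Q) \<le> B + N + exp (- real n)" for n
  proof -
    \<comment> \<open>the truncated log-density; the zeros of \<open>g\<close> are treated apart because \<open>ln 0 = 0\<close>\<close>
    define \<phi> where "\<phi> = (\<lambda>x. if g x = 0 then - real n else max (- real n) (min (real n) (ln (g x))))"
    have [measurable]: "\<phi> \<in> borel_measurable P" unfolding \<phi>_def by measurable
    have b: "\<bar>\<phi> x\<bar> \<le> real n" for x by (auto simp: \<phi>_def)
    have "(\<integral>x. \<phi> x \<partial>Q) + 1 \<le> (\<integral>x. exp (\<phi> x) \<partial>P) + B"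
      using relative_entropy_leD[OF le _ b] by simp
    moreover have "(\<integral>x. exp (\<phi> x) \<partial>P) \<le> (\<integral>x. g x + exp (- real n) \<partial>P)"
    proof (rule integral_mono)
      show "integrable P (\<lambda>x. exp (\<phi> x))" using integrable_bounded_prob[OF P, of \<phi> "real n"] b by auto
      show "integrable P (\<lambda>x. g x + exp (- real n))" using g(4) by auto
      fix x show "exp (\<phi> x) \<le> g x + exp (- real n)"
      proof (cases "g x = 0")
        case False
        then have pos: "g x > 0" using g(2)[of x] by simp
        have "\<phi> x = - real n \<or> \<phi> x \<le> ln (g x)" using False by (auto simp: \<phi>_def)
        then show ?thesis
        proof
          assume "\<phi> x \<le> ln (g x)"
          then have "exp (\<phi> x) \<le> g x" using pos by (metis exp_le_cancel_iff exp_ln)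
          then show ?thesis by (simp add: add_increasing2)
        qed (use pos in auto)
      qed (auto simp: \<phi>_def)
    qed
    moreover have "\<dots> = 1 + exp (- real n)" using g(4,5) by (simp add: P.prob_space)
    moreover have "(\<integral>x. \<phi> x \<partial>Q) = (\<integral>x. tp n x - tn n x \<partial>Q)"
    proof (rule integral_cong_AE)
      show "AE x in Q. \<phi> x = tp n x - tn n x"
      proof (use g(6) in eventually_elim)
        fix x assume "0 < g x"
        then have "\<phi> x = max (- real n) (min (real n) (ln (g x)))" by (auto simp: \<phi>_def)
        moreover have "max (- real n) (min (real n) y) = min (real n) (max 0 y) - min (real n) (max 0 (- y))" for y
          by (auto simp: max_def min_def)
        ultimately show "\<phi> x = tp n x - tn n x" by (simp only: tp_def tn_def)
      qed
      show "\<phi> \<in> borel_measurable Q" by (simp add: measurable_cong_sets[OF sets refl])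
      show "(\<lambda>x. tp n x - tn n x) \<in> borel_measurable Q" by measurable
    qed
    moreover have "\<dots> = (\<integral>x. tp n x \<partial>Q) - (\<integral>x. tn n x \<partial>Q)" using tint by simp
    ultimately show ?thesis using tnN[of n] by linarith
  qed
  \<comment> \<open>With \<open>n\<close> fixed, the estimate is taken at a later index
    \<open>j\<close>, where the truncated part is larger and the error \<open>exp (- j)\<close>
    tends to 0.\<close>
  have bound: "(\<integral>x. tp n x \<partial>Q) \<le> B + N" for n
  proof (rule LIMSEQ_le_const)
    have "(\<lambda>j. exp (- real j)) \<longlonglongrightarrow> 0"
      using LIMSEQ_realpow_zero[of "exp (- 1)"] by (simp add: exp_of_nat_mult[symmetric])
    from tendsto_add[OF tendsto_const[of "B + N"] this]
    show "(\<lambda>j. B + N + exp (- real j)) \<longlonglongrightarrow> B + N" by simp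
    show "\<exists>k. \<forall>j\<ge>k. (\<integral>x. tp n x \<partial>Q) \<le> B + N + exp (- real j)"
    proof (intro exI allI impI)
      fix j assume "n \<le> j"
      then have "(\<integral>x. tp n x \<partial>Q) \<le> (\<integral>x. tp j x \<partial>Q)"
        using tint by (intro integral_mono) (auto simp: tp_def min_def)
      with step[of j] show "(\<integral>x. tp n x \<partial>Q) \<le> B + N + exp (- real j)" by linarith
    qed
  qed
  have "?p = (\<integral>\<^sup>+x. (SUP n. ennreal (tp n x)) \<partial>Q)"
  proof (intro nn_integral_cong)
    fix x
    obtain m :: nat where m: "max 0 (ln (g x)) \<le> real m" using real_arch_simple by blast
    show "ennreal (ln (g x)) = (SUP n. ennreal (tp n x))"
    proof (rule antisym)
      have "ennreal (ln (g x)) \<le> ennreal (tp m x)"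
        using m by (auto simp: tp_def min_def max_def ennreal_neg intro!: ennreal_leI)
      also have "\<dots> \<le> (SUP n. ennreal (tp n x))" by (rule SUP_upper) simp
      finally show "ennreal (ln (g x)) \<le> (SUP n. ennreal (tp n x))" .
      show "(SUP n. ennreal (tp n x)) \<le> ennreal (ln (g x))"
        by (rule SUP_least) (auto simp: tp_def min_def max_def intro!: ennreal_leI)
    qed
  qed
  also have "\<dots> = (SUP n. \<integral>\<^sup>+x. ennreal (tp n x) \<partial>Q)"
    by (intro nn_integral_monotone_convergence_SUP)
      (auto simp: incseq_def le_fun_def tp_def min_def intro!: ennreal_leI)
  also have "\<dots> \<le> ennreal (B + N)"
    using bound tint tb by (intro SUP_least) (simp add: nn_integral_eq_integral ennreal_leI)
  finally have p: "?p \<le> ennreal (B + N)" .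
  have "0 \<le> B + N" using bound[of 0] tb by (simp add: tp_def)
  have "KL Q P = enn2ereal ?p - enn2ereal ?n" using ac by (simp add: KL_def ent)
  also have "enn2ereal ?p \<le> ereal (B + N)"
    using p \<open>0 \<le> B + N\<close> by (metis enn2ereal_ennreal less_eq_ennreal.rep_eq)
  then have "enn2ereal ?p - enn2ereal ?n \<le> ereal (B + N) - ereal N"
    using N by (intro ereal_minus_mono) (auto simp: enn2ereal_ennreal)
  finally show ?thesis by simp
qed

text \<open>The data processing inequality: \<open>\<phi>\<close> composed with \<open>T\<close> is
  again a bounded test function. It serves both for relabelling pairs as paths and for projecting
  paths to marginals.\<close>

lemma relative_entropy_le_distr:
  assumes le: "relative_entropy_le Q P B" and sets: "sets Q = sets P" and T: "T \<in> measurable P N"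
  shows "relative_entropy_le (distr Q N T) (distr P N T) B"
  unfolding relative_entropy_le_def
proof safe
  fix \<phi> :: "'b \<Rightarrow> real" and c
  assume "\<phi> \<in> borel_measurable (distr P N T)" and c: "\<forall>x. \<bar>\<phi> x\<bar> \<le> c"
  then have [measurable]: "\<phi> \<in> borel_measurable N" by simp
  note T[measurable]
  have [measurable]: "T \<in> measurable Q N" using T by (simp add: measurable_cong_sets[OF sets refl])
  have "(\<integral>x. \<phi> (T x) \<partial>Q) + 1 \<le> (\<integral>x. exp (\<phi> (T x)) \<partial>P) + B"
    using c by (intro relative_entropy_leD[OF le, of _ c]) auto
  then show "(\<integral>x. \<phi> x \<partial>distr Q N T) + 1 \<le> (\<integral>x. exp (\<phi> x) \<partial>distr P N T) + B"
    by (simp add: integral_distr)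
qed

section \<open>The standard Gaussian\<close>

lemma nn_integral_lborel_translate:
  fixes a :: "'a::euclidean_space"
  assumes [measurable]: "F \<in> borel_measurable borel"
  shows "(\<integral>\<^sup>+x. F (x + a) \<partial>lborel) = (\<integral>\<^sup>+x. F x \<partial>lborel)"
  by (subst lborel_distr_plus[symmetric, of a], subst nn_integral_distr) (auto simp: add.commute)

abbreviation std_gaussian_density :: "real ^ 'n \<Rightarrow> real" where
  "std_gaussian_density x \<equiv> (\<Prod>i\<in>UNIV. std_normal_density (x $ i))"

text \<open>In radial form a translation changes only the exponent.\<close>

lemma std_gaussian_density_eq: "std_gaussian_density (x :: real ^ 'n) = std_gaussian_density (0 :: real^'n) * exp (- (norm x)\<^sup>2 / 2)"
proof -
  have "std_gaussian_density x = (\<Prod>i\<in>UNIV. (1 / sqrt (2 * pi)) * exp (- (x $ i)\<^sup>2 / 2))"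
    by (simp add: std_normal_density_def)
  also have "\<dots> = (\<Prod>i\<in>(UNIV::'n set). 1 / sqrt (2 * pi)) * exp (\<Sum>i\<in>UNIV. - (x $ i)\<^sup>2 / 2)"
    by (simp only: prod.distrib exp_sum finite_class.finite_UNIV)
  also have "(\<Sum>i\<in>UNIV. - (x $ i)\<^sup>2 / 2) = - (norm x)\<^sup>2 / 2"
    by (simp add: norm_vec_def L2_set_def sum_nonneg sum_negf sum_divide_distrib)
  finally show ?thesis by (simp add: std_normal_density_def)
qed

lemma std_gaussian_density_measurable[measurable]: "(\<lambda>x::real^'n. std_gaussian_density x) \<in> borel_measurable borel"
  by measurable

lemma std_gaussian_density_nonneg[simp]: "0 \<le> std_gaussian_density (x::real^'n)" by (simp add: prod_nonneg)

lemma sets_std_gaussian[measurable_cong, simp]: "sets std_gaussian = sets borel"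
  by (simp add: std_gaussian_def)

lemma space_std_gaussian[simp]: "space std_gaussian = UNIV"
  by (simp add: std_gaussian_def)

lemma prob_space_std_gaussian: "prob_space (std_gaussian :: (real^'n) measure)"
proof
  \<comment> \<open>The coordinate product is rewritten over \<open>Basis\<close>, where the
    Lebesgue integral factorizes.\<close>
  have "(\<integral>\<^sup>+x. ennreal (std_gaussian_density x) \<partial>(lborel::(real^'n) measure))
      = (\<integral>\<^sup>+x. (\<Prod>b\<in>Basis. ennreal (std_normal_density (x \<bullet> b))) \<partial>(lborel::(real^'n) measure))"
  proof (intro nn_integral_cong)
    fix x :: "real^'n"
    have "(\<Prod>b\<in>Basis. ennreal (std_normal_density (x \<bullet> b)))
        = (\<Prod>i\<in>UNIV. ennreal (std_normal_density (x $ i)))"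
    proof (rule prod.reindex_cong[where l = "\<lambda>i. axis i 1"])
      show "inj (\<lambda>i. axis i (1::real) :: real^'n)" by (auto simp: inj_on_def axis_eq_axis)
      show "(Basis :: (real^'n) set) = range (\<lambda>i. axis i 1)" by (auto simp: Basis_vec_def)
    qed (simp add: inner_axis)
    also have "\<dots> = ennreal (std_gaussian_density x)" by (rule prod_ennreal) simp
    finally show "ennreal (std_gaussian_density x) = (\<Prod>b\<in>Basis. ennreal (std_normal_density (x \<bullet> b)))" ..
  qed
  also have "\<dots> = (\<Prod>b\<in>(Basis::(real^'n) set). \<integral>\<^sup>+x. ennreal (std_normal_density x) \<partial>lborel)"
    by (rule nn_integral_lborel_prod) auto
  also have "(\<integral>\<^sup>+x. ennreal (std_normal_density x) \<partial>lborel) = 1"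
    using prob_space.emeasure_space_1[OF prob_space_normal_density[OF zero_less_one, of 0]]
    by (subst (asm) emeasure_density) auto
  finally show "emeasure (std_gaussian :: (real^'n) measure) (space std_gaussian) = 1"
    by (simp add: std_gaussian_def emeasure_density)
qed

lemma nn_integral_std_gaussian:
  assumes [measurable]: "F \<in> borel_measurable borel"
  shows "(\<integral>\<^sup>+x. F x \<partial>std_gaussian) = (\<integral>\<^sup>+x. ennreal (std_gaussian_density x) * F x \<partial>lborel)"
  unfolding std_gaussian_def by (subst nn_integral_density) auto

text \<open>Lebesgue measure is translation invariant, and expanding the square of
  \<open>norm (x + a)\<close> gives the weight. Stating it for nonnegative integrals avoids
  integrability hypotheses; these are instead deduced from it below.\<close>

lemma std_gaussian_cameron_martin:
  fixes a :: "real^'n"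
  assumes [measurable]: "F \<in> borel_measurable borel"
  shows "(\<integral>\<^sup>+x. F x \<partial>std_gaussian)
    = (\<integral>\<^sup>+x. ennreal (exp (- (a \<bullet> x) - (norm a)\<^sup>2 / 2)) * F (x + a) \<partial>std_gaussian)"
proof -
  have "(\<integral>\<^sup>+x. F x \<partial>std_gaussian) = (\<integral>\<^sup>+x. ennreal (std_gaussian_density (x + a)) * F (x + a) \<partial>lborel)"
    unfolding nn_integral_std_gaussian[OF assms]
    by (subst nn_integral_lborel_translate[symmetric, of _ a]) auto
  also have "\<dots> = (\<integral>\<^sup>+x. ennreal (std_gaussian_density x) * (ennreal (exp (- (a \<bullet> x) - (norm a)\<^sup>2 / 2)) * F (x + a)) \<partial>lborel)"
  proof (intro nn_integral_cong)
    fix x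
    have "std_gaussian_density (x + a) = std_gaussian_density x * exp (- (a \<bullet> x) - (norm a)\<^sup>2 / 2)"
    proof -
      have "(norm (x + a))\<^sup>2 = (norm x)\<^sup>2 + 2 * (a \<bullet> x) + (norm a)\<^sup>2"
        by (simp add: power2_norm_eq_inner inner_add inner_commute)
      then have "- (norm (x + a))\<^sup>2 / 2 = - (norm x)\<^sup>2 / 2 + (- (a \<bullet> x) - (norm a)\<^sup>2 / 2)" by simp
      then show ?thesis
        unfolding std_gaussian_density_eq[of "x + a"] std_gaussian_density_eq[of x] mult.assoc exp_add[symmetric] by simp
    qed
    then show "ennreal (std_gaussian_density (x + a)) * F (x + a)
      = ennreal (std_gaussian_density x) * (ennreal (exp (- (a \<bullet> x) - (norm a)\<^sup>2 / 2)) * F (x + a))"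
      by (simp add: ennreal_mult mult.assoc)
  qed
  also have "\<dots> = (\<integral>\<^sup>+x. ennreal (exp (- (a \<bullet> x) - (norm a)\<^sup>2 / 2)) * F (x + a) \<partial>std_gaussian)"
    by (subst nn_integral_std_gaussian) auto
  finally show ?thesis .
qed

text \<open>Shifting the constant function 1 by \<open>- a\<close> gives the moment generating
  function \<open>exp ((norm a)^2 / 2)\<close>, hence finiteness.\<close>

lemma integrable_exp_inner_std_gaussian:
  fixes a :: "real^'n"
  shows "integrable std_gaussian (\<lambda>x. exp (a \<bullet> x))"
proof (rule integrableI_nonneg)
  have "1 = (\<integral>\<^sup>+x. ennreal (exp (a \<bullet> x - (norm a)\<^sup>2 / 2)) \<partial>(std_gaussian :: (real^'n) measure))"
    using std_gaussian_cameron_martin[of "\<lambda>_. 1" "- a"] prob_space.emeasure_space_1[OF prob_space_std_gaussian[where 'n = 'n]]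
    by simp
  then have "(\<integral>\<^sup>+x. ennreal (exp ((norm a)\<^sup>2 / 2)) * ennreal (exp (a \<bullet> x - (norm a)\<^sup>2 / 2)) \<partial>(std_gaussian :: (real^'n) measure))
      = ennreal (exp ((norm a)\<^sup>2 / 2))"
    by (subst nn_integral_cmult) auto
  then have "(\<integral>\<^sup>+x. ennreal (exp (a \<bullet> x)) \<partial>(std_gaussian :: (real^'n) measure))
      = ennreal (exp ((norm a)\<^sup>2 / 2))"
    by (simp add: ennreal_mult[symmetric] exp_add[symmetric])
  then show "(\<integral>\<^sup>+x. ennreal (exp (a \<bullet> x)) \<partial>(std_gaussian :: (real^'n) measure)) < \<infinity>" by simp
qed auto

section \<open>Moments of the standard Gaussian\<close>

lemma power_le_fact_exp: "0 \<le> x \<Longrightarrow> x ^ p \<le> fact p * exp (x::real)"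
proof -
  assume x: "0 \<le> x"
  have "x ^ p /\<^sub>R fact p \<le> (\<Sum>n. x ^ n /\<^sub>R fact n)"
    using x sum_le_suminf[OF summable_exp_generic[of x], of "{p}"] by auto
  then show ?thesis by (simp add: exp_def field_simps)
qed

lemma norm_power_le_sum:
  fixes x :: "real^'n"
  shows "norm x ^ p \<le> real CARD('n) ^ p * (\<Sum>i\<in>UNIV. \<bar>x $ i\<bar> ^ p)"
proof -
  have "Max (range (\<lambda>i. \<bar>x $ i\<bar>)) \<in> range (\<lambda>i. \<bar>x $ i\<bar>)" by (rule Max_in) auto
  then obtain j where "Max (range (\<lambda>i. \<bar>x $ i\<bar>)) = \<bar>x $ j\<bar>" by blast
  then have j: "\<bar>x $ i\<bar> \<le> \<bar>x $ j\<bar>" for i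
    using Max_ge[of "range (\<lambda>i. \<bar>x $ i\<bar>)" "\<bar>x $ i\<bar>"] by simp
  have "norm x \<le> (\<Sum>i\<in>UNIV. \<bar>x $ i\<bar>)" by (rule norm_le_l1_cart)
  also have "\<dots> \<le> real CARD('n) * \<bar>x $ j\<bar>"
    by (rule sum_bounded_above[of UNIV "\<lambda>i. \<bar>x $ i\<bar>" "\<bar>x $ j\<bar>"]) (rule j)
  finally have "norm x ^ p \<le> (real CARD('n) * \<bar>x $ j\<bar>) ^ p" by (intro power_mono) auto
  also have "\<dots> = real CARD('n) ^ p * \<bar>x $ j\<bar> ^ p" by (simp add: power_mult_distrib)
  also have "\<dots> \<le> real CARD('n) ^ p * (\<Sum>i\<in>UNIV. \<bar>x $ i\<bar> ^ p)"
    by (intro mult_left_mono member_le_sum) auto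
  finally show ?thesis .
qed

text \<open>Each coordinate power is dominated by one factorial times an exponential of the absolute
  value, hence by the sum of two exponential moments in the directions plus and minus that
  coordinate.\<close>

lemma integrable_norm_power_std_gaussian:
  "integrable (std_gaussian :: (real^'n) measure) (\<lambda>x. norm x ^ p)"
proof (rule Bochner_Integration.integrable_bound)
  let ?B = "\<lambda>x::real^'n. real CARD('n) ^ p * (\<Sum>i\<in>UNIV. fact p * (exp (axis i 1 \<bullet> x) + exp (axis i (-1) \<bullet> x)))"
  show "integrable (std_gaussian :: (real^'n) measure) ?B"
    by (intro integrable_mult_right Bochner_Integration.integrable_sum Bochner_Integration.integrable_add integrable_exp_inner_std_gaussian)
  have "norm x ^ p \<le> ?B x" for x :: "real^'n"
  proof -
    have "\<bar>x $ i\<bar> ^ p \<le> fact p * (exp (axis i 1 \<bullet> x) + exp (axis i (-1) \<bullet> x))" for i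
    proof -
      have "\<bar>x $ i\<bar> ^ p \<le> fact p * exp \<bar>x $ i\<bar>" by (rule power_le_fact_exp) simp
      also have "exp \<bar>x $ i\<bar> \<le> exp (x $ i) + exp (- (x $ i))" by (auto simp: abs_if)
      finally show ?thesis by (simp add: inner_axis')
    qed
    then show ?thesis
      by (intro order_trans[OF norm_power_le_sum] mult_left_mono sum_mono) auto
  qed
  then show "AE x in (std_gaussian :: (real^'n) measure). norm (norm x ^ p) \<le> norm (?B x)"
    by (auto intro!: AE_I2 order_trans[OF _ abs_ge_self])
qed auto

lemma integrable_inner_std_gaussian:
  "integrable (std_gaussian :: (real^'n) measure) (\<lambda>x. a \<bullet> x)"
proof (rule Bochner_Integration.integrable_bound)
  show "integrable (std_gaussian :: (real^'n) measure) (\<lambda>x. norm a * norm x ^ 1)"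
    by (intro integrable_mult_right integrable_norm_power_std_gaussian)
qed (auto simp: Cauchy_Schwarz_ineq2)

text \<open>The density is even, so the mean equals its own negative.\<close>

lemma integral_inner_std_gaussian: "(\<integral>x. a \<bullet> x \<partial>(std_gaussian :: (real^'n) measure)) = 0"
proof -
  have "distr std_gaussian borel uminus = (std_gaussian :: (real^'n) measure)"
  proof (rule measure_eqI)
    fix A :: "(real^'n) set" assume "A \<in> sets (distr std_gaussian borel uminus)"
    then have [measurable]: "A \<in> sets borel" by simp
    have "emeasure (distr std_gaussian borel uminus) A
      = (\<integral>\<^sup>+x. indicator A (- x) \<partial>(std_gaussian :: (real^'n) measure))"
      by (subst nn_integral_distr[of uminus _ borel "indicator A", symmetric]) auto
    also have "\<dots> = (\<integral>\<^sup>+x. ennreal (std_gaussian_density (- x)) * indicator A (- x) \<partial>lborel)"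
      by (subst nn_integral_std_gaussian) (auto simp: std_normal_density_def)
    also have "\<dots> = (\<integral>\<^sup>+x. ennreal (std_gaussian_density x) * indicator A x \<partial>(distr lborel borel uminus))"
      by (subst nn_integral_distr) auto
    also have "\<dots> = emeasure std_gaussian A"
      using lborel_affine[of "- 1" "0::real^'n"]
      by (simp add: nn_integral_std_gaussian[symmetric] density_1 scaleR_minus1_left)
    finally show "emeasure (distr std_gaussian borel uminus) A = emeasure std_gaussian A" .
  qed simp
  then have "(\<integral>x. a \<bullet> x \<partial>(std_gaussian :: (real^'n) measure)) = (\<integral>x. a \<bullet> x \<partial>distr std_gaussian borel uminus)"
    by simp
  also have "\<dots> = - (\<integral>x. a \<bullet> x \<partial>(std_gaussian :: (real^'n) measure))"
    by (subst integral_distr) auto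
  finally show ?thesis by simp
qed

text \<open>Jensen's inequality applied to the Cameron-Martin formula.\<close>

lemma gaussian_variational:
  fixes \<theta> :: "real^'n" and G :: "real^'n \<Rightarrow> real"
  assumes [measurable]: "G \<in> borel_measurable borel" and b: "\<And>x. \<bar>G x\<bar> \<le> c"
  shows "(\<integral>x. G (x + \<theta>) \<partial>std_gaussian)
    \<le> ln (\<integral>x. exp (G x) \<partial>std_gaussian) + (norm \<theta>)\<^sup>2 / 2"
proof -
  interpret prob_space "std_gaussian :: (real^'n) measure" by (rule prob_space_std_gaussian)
  let ?e = "\<lambda>x. exp (- (\<theta> \<bullet> x) - (norm \<theta>)\<^sup>2 / 2)"
  \<comment> \<open>After the shift the Cameron-Martin weight sits in the exponent. Its linear term
    has mean zero, so only the quadratic term survives in the expectation.\<close>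
  let ?X = "\<lambda>x. G (x + \<theta>) + (- (\<theta> \<bullet> x) - (norm \<theta>)\<^sup>2 / 2)"
  have iG: "integrable std_gaussian (\<lambda>x. exp (G x))" "integrable std_gaussian (\<lambda>x. G (x + \<theta>))"
    using integrable_bounded_prob[OF prob_space_std_gaussian, of G c]
      integrable_bounded_prob[OF prob_space_std_gaussian, of "\<lambda>x. G (x + \<theta>)" c] b by auto
  have "ennreal (\<integral>x. exp (G x) \<partial>std_gaussian) = (\<integral>\<^sup>+x. ennreal (exp (G x)) \<partial>std_gaussian)"
    using iG by (simp add: nn_integral_eq_integral)
  also have "\<dots> = (\<integral>\<^sup>+x. ennreal (exp (?X x)) \<partial>std_gaussian)"
    by (subst std_gaussian_cameron_martin[of _ \<theta>]) (auto simp: ennreal_mult[symmetric] exp_add[symmetric] add.commute)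
  finally have eq: "(\<integral>\<^sup>+x. ennreal (exp (?X x)) \<partial>std_gaussian) = ennreal (\<integral>x. exp (G x) \<partial>std_gaussian)" ..
  have iX: "integrable std_gaussian (\<lambda>x. exp (?X x))"
    using eq by (intro integrableI_nonneg) auto
  have eq': "expectation (\<lambda>x. exp (?X x)) = expectation (\<lambda>x. exp (G x))"
    using eq iX by (simp add: nn_integral_eq_integral)
  have i: "integrable std_gaussian ?X"
    using iG integrable_inner_std_gaussian[of \<theta>] by auto
  have EX: "expectation ?X = expectation (\<lambda>x. G (x + \<theta>)) - (norm \<theta>)\<^sup>2 / 2"
  proof -
    have "prob UNIV = 1" using prob_space by simp
    then show ?thesis
      using iG integrable_inner_std_gaussian[of \<theta>] by (simp add: integral_inner_std_gaussian)
  qed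
  have "exp (expectation ?X) \<le> expectation (\<lambda>x. exp (?X x))"
    by (rule jensens_inequality[where I = UNIV, OF i _ _ iX exp_convex]) simp_all
  then have "exp (expectation ?X) \<le> expectation (\<lambda>x. exp (G x))" unfolding eq' .
  then have "expectation ?X \<le> ln (expectation (\<lambda>x. exp (G x)))"
    by (subst ln_ge_iff) (auto intro: less_le_trans[OF exp_gt_zero])
  then show ?thesis unfolding EX by simp
qed

section \<open>Square roots of matrices\<close>

text \<open>Self-adjointness as an identity of inner products transfers to bounded operators and to
  limits, where the square roots below are found.\<close>

lemma symmetric_matrix_iff:
  fixes A :: "real^'n^'n"
  shows "transpose A = A \<longleftrightarrow> (\<forall>x y. x \<bullet> (A *v y) = (A *v x) \<bullet> y)"
proof
  assume "transpose A = A"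
  then show "\<forall>x y. x \<bullet> (A *v y) = (A *v x) \<bullet> y"
    by (metis dot_lmul_matrix transpose_matrix_vector)
next
  assume *: "\<forall>x y. x \<bullet> (A *v y) = (A *v x) \<bullet> y"
  have "(transpose A *v x) \<bullet> y = (A *v x) \<bullet> y" for x y
    by (metis * dot_lmul_matrix transpose_matrix_vector)
  then have "transpose A *v x = A *v x" for x
    by (metis vector_eq_rdot)
  then show "transpose A = A" by (simp add: matrix_eq)
qed

text \<open>
  A square root \<open>1 - Y\<close> of \<open>1 - B\<close> comes from a fixed point of \<open>Y \<mapsto> (B + Y Y) / 2\<close>, a contraction
  of the ball of radius \<open>1 - sqrt (1 - norm B)\<close>.
\<close>

lemma sqrt_near_identity:
  fixes B :: "'a::{banach,real_inner} \<Rightarrow>\<^sub>L 'a"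
  assumes B: "norm B < 1" and sym: "\<And>x y. x \<bullet> B y = B x \<bullet> y"
  obtains R :: "'a \<Rightarrow>\<^sub>L 'a" where "\<And>x y. x \<bullet> R y = R x \<bullet> y" "\<And>x. 0 \<le> x \<bullet> R x" "\<And>x. R (R x) = x - B x"
proof -
  \<comment> \<open>The smaller root of \<open>r^2 - 2 r + norm B = 0\<close>: exactly then the ball
    of radius \<open>r\<close> is mapped into itself, and \<open>r\<close> is also the contraction
    factor.\<close>
  define r where "r = 1 - sqrt (1 - norm B)"
  have "sqrt (1 - norm B) \<le> 1" by (rule real_le_lsqrt) (use B in auto)
  moreover have "0 < sqrt (1 - norm B)" using B by simp
  ultimately have r: "0 \<le> r" "r < 1" by (simp_all add: r_def)
  have "(1 - r)\<^sup>2 = 1 - norm B" using B by (simp add: r_def)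
  then have rr: "norm B + r * r = 2 * r" by (simp add: power2_eq_square algebra_simps)
  \<comment> \<open>Symmetry is built into the closed set, so the fixed point inherits it.\<close>
  define K where "K = {Y :: 'a \<Rightarrow>\<^sub>L 'a. norm Y \<le> r} \<inter> {Y :: 'a \<Rightarrow>\<^sub>L 'a. \<forall>x y. x \<bullet> Y y = Y x \<bullet> y}"
  have KD: "norm Y \<le> r" "x \<bullet> Y y = Y x \<bullet> y" if "Y \<in> K" for Y x y
    using that unfolding K_def by blast+
  define \<Phi> where "\<Phi> = (\<lambda>Y :: 'a \<Rightarrow>\<^sub>L 'a. (1/2) *\<^sub>R (B + (Y o\<^sub>L Y)))"
  have "closed K"
    unfolding K_def
    by (intro closed_Int closed_Collect_all closed_Collect_le closed_Collect_eq continuous_intros)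
  moreover have "0 \<in> K" using r by (simp add: K_def)
  then have "K \<noteq> {}" by blast
  moreover have "\<Phi> ` K \<subseteq> K"
  proof safe
    fix Y assume Y: "Y \<in> K"
    have "norm (Y o\<^sub>L Y) \<le> r * r"
      using KD(1)[OF Y] r by (intro order_trans[OF norm_blinfun_compose] mult_mono) auto
    then have "norm (B + (Y o\<^sub>L Y)) \<le> 2 * r" using rr norm_triangle_ineq[of B "Y o\<^sub>L Y"] by linarith
    then have "norm (\<Phi> Y) \<le> r" by (simp add: \<Phi>_def)
    moreover have "x \<bullet> \<Phi> Y y = \<Phi> Y x \<bullet> y" for x y
      unfolding \<Phi>_def
      by (simp add: blinfun.bilinear_simps inner_add_left inner_add_right)
        (simp only: KD(2)[OF Y] sym)
    ultimately show "\<Phi> Y \<in> K" unfolding K_def by blast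
  qed
  moreover have "\<forall>Y\<in>K. \<forall>Z\<in>K. dist (\<Phi> Y) (\<Phi> Z) \<le> r * dist Y Z"
  proof safe
    fix Y Z assume YZ: "Y \<in> K" "Z \<in> K"
    \<comment> \<open>The splitting \<open>Y Y - Z Z = Y (Y - Z) + (Y - Z) Z\<close> does not need
      \<open>Y\<close> and \<open>Z\<close> to commute.\<close>
    have eq: "\<Phi> Y - \<Phi> Z = (1/2) *\<^sub>R ((Y o\<^sub>L (Y - Z)) + ((Y - Z) o\<^sub>L Z))"
      by (rule blinfun_eqI) (simp add: \<Phi>_def blinfun.bilinear_simps algebra_simps)
    have "norm (Y o\<^sub>L (Y - Z)) \<le> r * norm (Y - Z)" "norm ((Y - Z) o\<^sub>L Z) \<le> norm (Y - Z) * r"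
      using KD(1) YZ r by (intro order_trans[OF norm_blinfun_compose] mult_mono; simp)+
    then have "norm ((Y o\<^sub>L (Y - Z)) + ((Y - Z) o\<^sub>L Z)) \<le> 2 * (r * norm (Y - Z))"
      using norm_triangle_ineq[of "Y o\<^sub>L (Y - Z)" "(Y - Z) o\<^sub>L Z"] by (simp add: mult.commute)
    then show "dist (\<Phi> Y) (\<Phi> Z) \<le> r * dist Y Z" by (simp add: dist_norm eq)
  qed
  ultimately obtain Y where Y: "Y \<in> K" "\<Phi> Y = Y" using Banach_fix[of K r \<Phi>] r by (auto simp: complete_eq_closed)
  have YY: "Y (Y x) = 2 *\<^sub>R Y x - B x" for x
  proof -
    have "2 *\<^sub>R Y x = 2 *\<^sub>R \<Phi> Y x" using Y by simp
    then show ?thesis by (simp add: \<Phi>_def blinfun.bilinear_simps)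
  qed
  show thesis
  proof
    let ?R = "id_blinfun - Y"
    show "x \<bullet> ?R y = ?R x \<bullet> y" for x y
      using KD(2)[OF Y(1), of x y] by (simp add: blinfun.bilinear_simps inner_diff_left inner_diff_right)
    show "?R (?R x) = x - B x" for x
      by (simp add: blinfun.bilinear_simps YY scaleR_2)
    show "0 \<le> x \<bullet> ?R x" for x
    proof -
      have "x \<bullet> Y x \<le> norm x * (norm Y * norm x)"
        by (rule order_trans[OF norm_cauchy_schwarz]) (intro mult_left_mono norm_blinfun norm_ge_zero)
      also have "\<dots> \<le> norm x * (1 * norm x)"
        using KD(1)[OF Y(1)] r by (intro mult_left_mono mult_right_mono) auto
      finally show ?thesis
        by (simp add: blinfun.bilinear_simps inner_diff_right power2_norm_eq_inner[symmetric] power2_eq_square)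
    qed
  qed
qed

section \<open>From roots near the identity to all positive semi-definite matrices\<close>

lemma matrix_vector_mult_bound:
  fixes A :: "real^'n^'m"
  obtains K where "0 < K" "\<And>x. norm (A *v x) \<le> K * norm x"
  using bounded_linear.pos_bounded[OF matrix_vector_mul_bounded_linear[of A]] by (metis mult.commute)

text \<open>The quadratic form attains a positive minimum on the compact unit sphere; homogeneity
  extends the bound to all vectors.\<close>

lemma pos_def_coercive:
  fixes A :: "real^'n^'n"
  assumes "pos_def A"
  obtains s where "0 < s" "\<And>x. s * (norm x)\<^sup>2 \<le> x \<bullet> (A *v x)"
proof -
  let ?S = "sphere (0::real^'n) 1"
  have "compact ?S" "?S \<noteq> {}" by auto
  moreover have "continuous_on ?S (\<lambda>x. x \<bullet> (A *v x))" by (intro continuous_intros)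
  ultimately obtain x0 where x0: "x0 \<in> ?S" "\<And>x. x \<in> ?S \<Longrightarrow> x0 \<bullet> (A *v x0) \<le> x \<bullet> (A *v x)"
    using continuous_attains_inf[of ?S] by blast
  show thesis
  proof
    have "x0 \<noteq> 0" using x0(1) by auto
    then show "0 < x0 \<bullet> (A *v x0)" using assms by (simp add: pos_def_def)
    show "x0 \<bullet> (A *v x0) * (norm x)\<^sup>2 \<le> x \<bullet> (A *v x)" for x
    proof (cases "x = 0")
      case False
      have "x0 \<bullet> (A *v x0) \<le> (x /\<^sub>R norm x) \<bullet> (A *v (x /\<^sub>R norm x))"
        using False by (intro x0(2)) simp
      also have "\<dots> = (x \<bullet> (A *v x)) / (norm x)\<^sup>2"
        by (simp add: matrix_vector_mult_scaleR power2_eq_square divide_inverse mult_ac)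
      finally show ?thesis using False by (simp add: field_simps)
    qed simp
  qed
qed

lemma pos_def_imp_pos_semidef: "pos_def A \<Longrightarrow> pos_semidef A"
  unfolding pos_def_def pos_semidef_def by (metis inner_zero_left order_less_imp_le order_refl)

text \<open>After division by a large \<open>c\<close>, the matrix is close enough to the identity
  for \<open>sqrt_near_identity\<close>; the root found there is multiplied by
  \<open>sqrt c\<close>.\<close>

lemma pos_def_sqrt_exists:
  fixes A :: "real^'n^'n"
  assumes A: "pos_def A"
  obtains R where "pos_semidef R" "R ** R = A"
proof -
  obtain K where K: "0 < K" "\<And>x. norm (A *v x) \<le> K * norm x" by (rule matrix_vector_mult_bound[of A]) blast
  obtain s where s: "0 < s" "\<And>x. s * (norm x)\<^sup>2 \<le> x \<bullet> (A *v x)" using pos_def_coercive[OF A] by blast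
  \<comment> \<open>The square of the norm of \<open>x - A x / c\<close> is at most
    \<open>1 - 2 s / c + K^2 / c^2\<close> times that of \<open>x\<close>. With
    \<open>K^2 = c * s\<close> this factor becomes \<open>q = 1 - s / c < 1\<close>.\<close>
  define c where "c = K\<^sup>2 / s"
  have c: "0 < c" using K s by (simp add: c_def)
  define q where "q = 1 - s / c"
  define B where "B = Blinfun (\<lambda>x. x - (1 / c) *\<^sub>R (A *v x))"
  have Bx: "blinfun_apply B = (\<lambda>x. x - (1 / c) *\<^sub>R (A *v x))"
    unfolding B_def by (rule bounded_linear_Blinfun_apply) (intro bounded_linear_intros matrix_vector_mul_bounded_linear)
  have sq: "(norm (B x))\<^sup>2 \<le> q * (norm x)\<^sup>2" for x
  proof -
    have "(norm (B x))\<^sup>2 = (norm x)\<^sup>2 - 2 / c * (x \<bullet> (A *v x)) + (norm (A *v x))\<^sup>2 / c\<^sup>2"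
      unfolding power2_norm_eq_inner Bx
      by (simp add: inner_diff_left inner_diff_right inner_commute power2_eq_square field_simps)
    also have "\<dots> \<le> (norm x)\<^sup>2 - 2 / c * (s * (norm x)\<^sup>2) + (K * norm x)\<^sup>2 / c\<^sup>2"
      using c s(2) K(2) by (intro add_mono diff_mono mult_left_mono divide_right_mono power_mono) auto
    also have "(K * norm x)\<^sup>2 / c\<^sup>2 = s / c * (norm x)\<^sup>2"
      using c K s by (simp add: c_def power2_eq_square field_simps)
    finally show ?thesis by (simp add: q_def algebra_simps)
  qed
  have "0 \<le> q"
    using order_trans[OF zero_le_power2 sq[of "axis undefined 1"]] by simp
  have "q < 1" using s c by (simp add: q_def)
  have "norm (B x) \<le> sqrt q * norm x" for x
    using real_sqrt_le_mono[OF sq[of x]] by (simp add: real_sqrt_mult)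
  then have "norm B \<le> sqrt q" by (intro norm_blinfun_bound) (simp_all add: \<open>0 \<le> q\<close>)
  also have "\<dots> < 1" using \<open>q < 1\<close> by simp
  finally have nB: "norm B < 1" .
  have symA: "x \<bullet> (A *v y) = (A *v x) \<bullet> y" for x y
    using A symmetric_matrix_iff[of A] by (simp add: pos_def_def)
  have symB: "x \<bullet> B y = B x \<bullet> y" for x y
    using symA[of x y] by (simp add: Bx inner_diff_left inner_diff_right)
  obtain R :: "(real^'n) \<Rightarrow>\<^sub>L (real^'n)" where R: "\<And>x y. x \<bullet> R y = R x \<bullet> y" "\<And>x. 0 \<le> x \<bullet> R x" "\<And>x. R (R x) = x - B x"
    by (rule sqrt_near_identity[OF nB symB]) blast
  define M where "M = matrix (\<lambda>x. sqrt c *\<^sub>R R x)"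
  have M: "M *v x = sqrt c *\<^sub>R R x" for x
  proof -
    have "bounded_linear (\<lambda>x. sqrt c *\<^sub>R R x)" by (intro bounded_linear_intros)
    from fun_cong[OF matrix_vector_mul(3)[OF this], of x] show ?thesis unfolding M_def .
  qed
  show thesis
  proof
    show "pos_semidef M"
      unfolding pos_semidef_def symmetric_matrix_iff M using R c by (auto intro!: mult_nonneg_nonneg)
    have "(M ** M) *v x = A *v x" for x
      using c by (simp add: matrix_vector_mul_assoc[symmetric] M blinfun.scaleR_right R Bx)
    then show "M ** M = A" by (simp add: matrix_eq)
  qed
qed

text \<open>All later estimates on a root go through this identity, so they depend only on
  \<open>A\<close> and not on which root is chosen.\<close>

lemma norm_pos_semidef_sqrt:
  assumes "pos_semidef R" "R ** R = A"
  shows "(norm (R *v x))\<^sup>2 = x \<bullet> (A *v x)"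
  using assms symmetric_matrix_iff[of R]
  by (auto simp: power2_norm_eq_inner pos_semidef_def matrix_vector_mul_assoc[symmetric])

text \<open>Adding small multiples of the identity gives positive definite matrices. Their roots are
  uniformly bounded by the norm identity, so a subsequence converges; symmetry, nonnegativity and
  the equation for the square pass to the limit.\<close>

lemma pos_semidef_sqrt_exists:
  fixes A :: "real^'n^'n"
  assumes A: "pos_semidef A"
  obtains R where "pos_semidef R" "R ** R = A"
proof -
  define A' where "A' n = A + inverse (real (Suc n)) *\<^sub>R mat 1" for n
  have A'x: "A' n *v x = A *v x + inverse (real (Suc n)) *\<^sub>R x" for n x
    by (simp add: A'_def matrix_vector_mult_add_rdistrib scaleR_matrix_vector_assoc[symmetric])
  have "pos_def (A' n)" for n
  proof -
    have "0 < x \<bullet> (A' n *v x)" if "x \<noteq> 0" for x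
      using A that by (auto simp: A'x inner_add_right pos_semidef_def intro!: add_nonneg_pos)
    moreover have "transpose (A' n) = A' n"
      using A unfolding symmetric_matrix_iff pos_semidef_def
      by (simp add: A'x inner_add_right inner_add_left)
    ultimately show ?thesis by (simp add: pos_def_def)
  qed
  then have "\<exists>R. pos_semidef R \<and> R ** R = A' n" for n using pos_def_sqrt_exists by blast
  then obtain R where R: "\<And>n. pos_semidef (R n)" "\<And>n. R n ** R n = A' n" by metis
  obtain K where K: "0 < K" "\<And>x. norm (A *v x) \<le> K * norm x" by (rule matrix_vector_mult_bound[of A]) blast
  have Rb: "norm (R n *v x) \<le> sqrt (K + 1) * norm x" for n x
  proof -
    have "(norm (R n *v x))\<^sup>2 = x \<bullet> (A' n *v x)" by (rule norm_pos_semidef_sqrt[OF R])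
    also have "\<dots> \<le> norm x * norm (A' n *v x)" by (rule norm_cauchy_schwarz)
    also have "\<dots> \<le> norm x * (K * norm x + 1 * norm x)"
      unfolding A'x by (intro mult_left_mono norm_triangle_le add_mono K)
        (auto intro!: mult_left_le_one_le simp: inverse_le_1_iff simp del: of_nat_Suc)
    also have "\<dots> = (sqrt (K + 1) * norm x)\<^sup>2" using K(1) by (simp add: power2_eq_square algebra_simps)
    finally show ?thesis using K(1) by (intro power2_le_imp_le[of "norm _"]) auto
  qed
  have comp: "\<bar>R n $ i $ j\<bar> \<le> sqrt (K + 1)" for n i j
  proof -
    have "R n $ i $ j = (R n *v axis j 1) $ i" by (simp add: matrix_vector_mul_component inner_axis)
    then show ?thesis
      using component_le_norm_cart[of "R n *v axis j 1" i] Rb[of n "axis j 1"] by simp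
  qed
  have "norm (R n) \<le> (\<Sum>i\<in>(UNIV::'n set). \<Sum>j\<in>(UNIV::'n set). sqrt (K + 1))" for n
  proof -
    have "norm (R n) \<le> (\<Sum>i\<in>UNIV. norm (R n $ i))"
      unfolding norm_vec_def[of "R n"] by (rule L2_set_le_sum) simp
    also have "\<dots> \<le> (\<Sum>i\<in>UNIV. \<Sum>j\<in>UNIV. \<bar>R n $ i $ j\<bar>)" by (intro sum_mono norm_le_l1_cart)
    also have "\<dots> \<le> (\<Sum>i\<in>(UNIV::'n set). \<Sum>j\<in>(UNIV::'n set). sqrt (K + 1))" by (intro sum_mono comp)
    finally show ?thesis .
  qed
  then have "bounded (range R)" by (auto simp: bounded_iff)
  then obtain L r where r: "strict_mono r" and L: "(R \<circ> r) \<longlonglongrightarrow> L"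
    using bounded_imp_convergent_subsequence by blast
  have Lij: "(\<lambda>n. R (r n) $ i $ j) \<longlonglongrightarrow> L $ i $ j" for i j
    using L by (intro tendsto_vec_nth) (simp add: comp_def)
  have Lv: "(\<lambda>n. R (r n) *v x) \<longlonglongrightarrow> L *v x" for x
    unfolding matrix_vector_mult_def by (intro vec_tendstoI) (auto intro!: tendsto_intros Lij)
  show thesis
  proof
    have "x \<bullet> (L *v y) = (L *v x) \<bullet> y" for x y
    proof (rule LIMSEQ_unique)
      show "(\<lambda>n. x \<bullet> (R (r n) *v y)) \<longlonglongrightarrow> x \<bullet> (L *v y)" by (intro tendsto_intros Lv)
      have "x \<bullet> (R (r n) *v y) = (R (r n) *v x) \<bullet> y" for n
        using R(1)[of "r n"] symmetric_matrix_iff[of "R (r n)"] by (simp add: pos_semidef_def)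
      then show "(\<lambda>n. x \<bullet> (R (r n) *v y)) \<longlonglongrightarrow> (L *v x) \<bullet> y" by (auto intro!: tendsto_intros Lv)
    qed
    moreover have "0 \<le> x \<bullet> (L *v x)" for x
      using R(1) by (intro LIMSEQ_le_const[OF tendsto_inner[OF tendsto_const Lv]]) (auto simp: pos_semidef_def)
    ultimately show "pos_semidef L" by (auto simp: pos_semidef_def symmetric_matrix_iff)
    have "(\<lambda>n. (R (r n) ** R (r n)) $ i $ j) \<longlonglongrightarrow> (L ** L) $ i $ j" for i j
      unfolding matrix_matrix_mult_def by (auto intro!: tendsto_intros Lij)
    moreover have "(\<lambda>n. (R (r n) ** R (r n)) $ i $ j) \<longlonglongrightarrow> A $ i $ j" for i j
    proof -
      have "(\<lambda>n. A' n $ i $ j) \<longlonglongrightarrow> A $ i $ j + 0 * mat 1 $ i $ j"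
        unfolding A'_def vector_add_component vector_scaleR_component real_scaleR_def
        by (rule tendsto_add[OF tendsto_const tendsto_mult[OF LIMSEQ_inverse_real_of_nat tendsto_const]])
      from LIMSEQ_subseq_LIMSEQ[OF this r] show ?thesis by (simp add: R(2) comp_def)
    qed
    ultimately have "(L ** L) $ i $ j = A $ i $ j" for i j using LIMSEQ_unique by blast
    then show "L ** L = A" by (simp add: vec_eq_iff)
  qed
qed

lemma matrix_sqrt:
  assumes "pos_semidef A"
  shows "pos_semidef (matrix_sqrt A)" "matrix_sqrt A ** matrix_sqrt A = A"
  using pos_semidef_sqrt_exists[OF assms] unfolding matrix_sqrt_def by (metis (mono_tags, lifting) someI_ex)+

lemma norm_matrix_sqrt: "pos_semidef A \<Longrightarrow> (norm (matrix_sqrt A *v x))\<^sup>2 = x \<bullet> (A *v x)"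
  using norm_pos_semidef_sqrt matrix_sqrt by blast

lemma pos_semidef_scaleR: "pos_semidef A \<Longrightarrow> 0 \<le> c \<Longrightarrow> pos_semidef (c *\<^sub>R A)"
  unfolding pos_semidef_def symmetric_matrix_iff by (auto simp: scaleR_matrix_vector_assoc[symmetric] simp del: inner_commute)

section \<open>Second-order Taylor estimate\<close>

lemma add_power_le: "0 \<le> u \<Longrightarrow> 0 \<le> v \<Longrightarrow> (u + v) ^ p \<le> 2 ^ p * (u ^ p + v ^ p :: real)"
proof -
  assume uv: "0 \<le> u" "0 \<le> v"
  have "(u + v) ^ p \<le> (2 * max u v) ^ p" using uv by (intro power_mono) auto
  also have "\<dots> = 2 ^ p * max u v ^ p" by (simp add: power_mult_distrib)
  also have "\<dots> \<le> 2 ^ p * (u ^ p + v ^ p)" using uv by (intro mult_left_mono) (auto simp: max_def)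
  finally show ?thesis .
qed

lemma partial_deriv_eq:
  fixes g :: "real^'n \<Rightarrow> real"
  assumes "(g has_derivative g') (at x)"
  shows "partial_deriv i g x = g' (axis i 1)"
proof -
  have "((\<lambda>t. g (x + t *\<^sub>R axis i 1)) has_derivative (\<lambda>t. g' (t *\<^sub>R axis i 1))) (at 0)"
    by (rule has_derivative_compose[where f = "\<lambda>t. x + t *\<^sub>R axis i 1" and g = g])
      (use assms in \<open>auto intro!: derivative_eq_intros\<close>)
  moreover have "g' (t *\<^sub>R axis i 1) = t * g' (axis i 1)" for t
    using linear_scale[OF has_derivative_linear[OF assms]] by simp
  ultimately have "((\<lambda>t. g (x + t *\<^sub>R axis i 1)) has_field_derivative g' (axis i 1)) (at 0)"
    by (simp add: has_field_derivative_def mult.commute[of _ "g' (axis i 1)"])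
  then show ?thesis unfolding partial_deriv_def by (rule DERIV_imp_deriv)
qed

lemma blinfun_axis_expansion:
  fixes F :: "(real^'n) \<Rightarrow>\<^sub>L 'b::real_normed_vector"
  shows "F w = (\<Sum>i\<in>UNIV. w $ i *\<^sub>R F (axis i 1))"
proof -
  have "F w = F (\<Sum>i\<in>UNIV. w $ i *\<^sub>R axis i 1)"
    using basis_expansion[of w] by (simp add: scalar_mult_eq_scaleR)
  then show ?thesis by (simp add: blinfun.sum_right blinfun.scaleR_right)
qed

text \<open>The growth bound is centred at the origin; recentring it at \<open>m\<close> makes the
  remainder depend on \<open>x - m\<close> alone. The constant depends on \<open>m\<close>, which is
  harmless since only finitely many points of the Euler sequence occur.\<close>

lemma second_order_taylor:
  fixes f :: "real^'n \<Rightarrow> real^'n"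
  assumes "standing_assumption f T"
  obtains C s where "0 < C"
    "\<And>x. norm (f x - f m - jacobian f (at m) *v (x - m)) \<le> C * (1 + norm (x - m) ^ s) * (norm (x - m))\<^sup>2"
proof -
  from assms obtain f' f'' where
    D1: "\<And>x. (f has_derivative blinfun_apply (f' x)) (at x)" and
    D2: "\<And>x. (f' has_derivative blinfun_apply (f'' x)) (at x)"
    unfolding standing_assumption_def C2_def by blast
  from assms obtain c s where c: "0 < c" and
    bd: "\<And>d i j u. \<bar>partial_deriv i (partial_deriv j (\<lambda>x. f x $ d)) u\<bar> \<le> c * (1 + norm u ^ s)"
    unfolding standing_assumption_def by blast
  have jac: "jacobian f (at m) *v w = f' m w" for w
  proof -
    have "f differentiable at m" using D1 by (auto simp: differentiable_def)
    then have "(f has_derivative (\<lambda>h. jacobian f (at m) *v h)) (at m)" by (simp add: jacobian_works)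
    from has_derivative_unique[OF this D1] show ?thesis by (rule fun_cong)
  qed
  \<comment> \<open>An identity of functions rather than of values, because it is differentiated
    once more.\<close>
  have pd1: "partial_deriv j (\<lambda>x. f x $ d) = (\<lambda>u. f' u (axis j 1) $ d)" for j d
    by (rule ext, rule partial_deriv_eq) (rule bounded_linear.has_derivative[OF bounded_linear_vec_nth, OF D1])
  have pd2: "partial_deriv i (partial_deriv j (\<lambda>x. f x $ d)) u = f'' u (axis i 1) (axis j 1) $ d" for i j d u
    unfolding pd1
    by (rule partial_deriv_eq[of _ "\<lambda>h. f'' u h (axis j 1) $ d"])
      (intro bounded_linear.has_derivative[OF bounded_linear_vec_nth] bounded_bilinear.FDERIV[OF bounded_bilinear_blinfun_apply, OF D2 has_derivative_const, THEN has_derivative_eq_rhs], simp add: blinfun.bilinear_simps)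
  define n where "n = real CARD('n)"
  have hess: "\<bar>f'' u w w $ d\<bar> \<le> c * (1 + norm u ^ s) * (n * norm w)\<^sup>2" for u w d
  proof -
    have "f'' u w w $ d = (\<Sum>i\<in>UNIV. \<Sum>j\<in>UNIV. w $ i * w $ j * (f'' u (axis i 1) (axis j 1) $ d))"
    proof -
      have "f'' u w w = (\<Sum>i\<in>UNIV. w $ i *\<^sub>R f'' u (axis i 1) w)"
        by (subst blinfun_axis_expansion[of "f'' u" w]) (simp add: blinfun.sum_left blinfun.scaleR_left)
      also have "\<dots> = (\<Sum>i\<in>UNIV. \<Sum>j\<in>UNIV. w $ i *\<^sub>R w $ j *\<^sub>R f'' u (axis i 1) (axis j 1))"
        by (intro sum.cong refl, subst blinfun_axis_expansion[of _ w]) (simp add: scaleR_sum_right)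
      finally show ?thesis by (simp add: mult.assoc)
    qed
    also have "\<bar>\<dots>\<bar> \<le> (\<Sum>i\<in>(UNIV::'n set). \<Sum>j\<in>(UNIV::'n set). norm w * norm w * (c * (1 + norm u ^ s)))"
      by (intro order_trans[OF sum_abs] sum_mono)
        (auto simp: abs_mult pd2[symmetric] intro!: mult_mono bd component_le_norm_cart)
    also have "\<dots> = c * (1 + norm u ^ s) * (n * norm w)\<^sup>2"
      by (simp add: n_def power2_eq_square)
    finally show ?thesis .
  qed
  \<comment> \<open>Absorbs \<open>norm m\<close>: from \<open>add_power_le\<close>,
    \<open>1 + norm (m + t *\<^sub>R w) ^ s\<close> is at most
    \<open>P * (1 + norm w ^ s)\<close>.\<close>
  define P where "P = 1 + 2 ^ s * norm m ^ s + 2 ^ s"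
  have P: "1 \<le> P" "0 \<le> P" by (simp_all add: P_def)
  have comp: "\<bar>(f x - f m - f' m (x - m)) $ d\<bar> \<le> c * (P * (1 + norm (x - m) ^ s)) * (n * norm (x - m))\<^sup>2" for x d
  proof -
    define w where "w = x - m"
    \<comment> \<open>Restricting a single component to the segment from \<open>m\<close> to
      \<open>x\<close> permits the real-valued Maclaurin formula; the intermediate point may differ
      between components. Only the entries 0, 1 and 2 of the family matter.\<close>
    define diff where "diff = (\<lambda>k t. if k = 0 then f (m + t *\<^sub>R w) $ d
      else if k = Suc 0 then f' (m + t *\<^sub>R w) w $ d else f'' (m + t *\<^sub>R w) w w $ d)"
    have line: "((\<lambda>t. m + t *\<^sub>R w) has_derivative (\<lambda>h. h *\<^sub>R w)) (at t)" for t
      by (auto intro!: derivative_eq_intros)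
    have d0: "(diff 0 has_real_derivative diff (Suc 0) t) (at t)" for t
    proof -
      have "((\<lambda>t. f (m + t *\<^sub>R w)) has_derivative (\<lambda>h. f' (m + t *\<^sub>R w) (h *\<^sub>R w))) (at t)"
        by (rule has_derivative_compose[OF line D1])
      from bounded_linear.has_derivative[OF bounded_linear_vec_nth[of d], OF this] show ?thesis
        by (simp add: has_field_derivative_def diff_def blinfun.bilinear_simps mult_commute_abs)
    qed
    have d1: "(diff (Suc 0) has_real_derivative diff 2 t) (at t)" for t
    proof -
      have "((\<lambda>t. f' (m + t *\<^sub>R w)) has_derivative (\<lambda>h. f'' (m + t *\<^sub>R w) (h *\<^sub>R w))) (at t)"
        by (rule has_derivative_compose[OF line D2])
      from bounded_linear.has_derivative[OF bounded_linear_vec_nth[of d], OF bounded_bilinear.FDERIV[OF bounded_bilinear_blinfun_apply, OF this has_derivative_const[of w]]] show ?thesis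
        by (simp add: has_field_derivative_def diff_def blinfun.bilinear_simps mult_commute_abs)
    qed
    have "\<exists>t::real. 0 < t \<and> t < 1 \<and>
      f (m + 1 *\<^sub>R w) $ d = (\<Sum>k<2. (diff k 0 / fact k) * 1 ^ k) + (diff 2 t / fact 2) * 1 ^ 2"
    proof (rule Maclaurin)
      show "\<forall>k t. k < 2 \<and> 0 \<le> t \<and> t \<le> 1 \<longrightarrow> (diff k has_real_derivative diff (Suc k) t) (at t)"
        using d0 d1[unfolded numeral_2_eq_2] by (auto dest!: less_2_cases)
    qed (auto simp: diff_def)
    then obtain t where t: "0 < t" "t < 1" and
      eq: "f x $ d = (\<Sum>k<2. (diff k 0 / fact k) * 1 ^ k) + (diff 2 t / fact 2) * 1 ^ 2"
      by (auto simp: w_def)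
    have "(\<Sum>k<2. (diff k 0 / fact k) * 1 ^ k) = f m $ d + f' m w $ d"
      by (simp add: numeral_2_eq_2 diff_def)
    then have "(f x - f m - f' m w) $ d = f'' (m + t *\<^sub>R w) w w $ d / 2"
      using eq by (simp add: diff_def)
    then have "\<bar>(f x - f m - f' m w) $ d\<bar> \<le> \<bar>f'' (m + t *\<^sub>R w) w w $ d\<bar>" by simp
    also have "\<dots> \<le> c * (1 + norm (m + t *\<^sub>R w) ^ s) * (n * norm w)\<^sup>2" by (rule hess)
    also have "\<dots> \<le> c * (P * (1 + norm w ^ s)) * (n * norm w)\<^sup>2"
    proof -
      have "norm (m + t *\<^sub>R w) \<le> norm m + norm w"
        using t by (intro norm_triangle_le add_mono order_refl) (simp add: mult_left_le_one_le)
      then have "norm (m + t *\<^sub>R w) ^ s \<le> (norm m + norm w) ^ s" by (rule power_mono) simp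
      also have "\<dots> \<le> 2 ^ s * norm m ^ s + 2 ^ s * norm w ^ s"
        using add_power_le[of "norm m" "norm w" s] by (simp add: distrib_left)
      also have "\<dots> + 1 \<le> P * (1 + norm w ^ s)"
        by (simp add: P_def algebra_simps add_increasing2)
      finally have "1 + norm (m + t *\<^sub>R w) ^ s \<le> P * (1 + norm w ^ s)" by simp
      then show ?thesis using c by (intro mult_right_mono mult_left_mono) auto
    qed
    finally show ?thesis by (simp add: w_def)
  qed
  show thesis
  proof
    show "0 < n * c * P * n\<^sup>2" using c P by (simp add: n_def)
    fix x
    have "norm (f x - f m - f' m (x - m)) \<le> (\<Sum>d\<in>UNIV. \<bar>(f x - f m - f' m (x - m)) $ d\<bar>)"
      by (rule norm_le_l1_cart)
    also have "\<dots> \<le> (\<Sum>d\<in>(UNIV::'n set). c * (P * (1 + norm (x - m) ^ s)) * (n * norm (x - m))\<^sup>2)"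
      by (intro sum_mono comp)
    also have "\<dots> = n * c * P * n\<^sup>2 * (1 + norm (x - m) ^ s) * (norm (x - m))\<^sup>2"
      by (simp add: n_def power2_eq_square)
    finally show "norm (f x - f m - jacobian f (at m) *v (x - m))
      \<le> n * c * P * n\<^sup>2 * (1 + norm (x - m) ^ s) * (norm (x - m))\<^sup>2" by (simp only: jac)
  qed
qed

lemma standing_assumption_continuous: "standing_assumption f T \<Longrightarrow> continuous_on UNIV f"
  unfolding standing_assumption_def C2_def
  by (meson has_derivative_continuous_on has_derivative_at_withinI)

section \<open>Chains with Gaussian noise\<close>

text \<open>Substitute for the chain rule. For fixed \<open>x\<close> the drift \<open>b\<close> is
  the drift \<open>a\<close> with its noise translated by \<open>\<theta> x\<close>, so the Gaussian
  inequality bounds the inner integral; the hypothesis on Q and P then handles the outer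
  one.\<close>

lemma relative_entropy_le_step:
  fixes a b :: "'a \<Rightarrow> real^'n" and R :: "real^'n^'n"
  assumes P: "prob_space P" and Q: "prob_space Q" and sets: "sets Q = sets P"
    and le: "relative_entropy_le Q P B"
    and ab[measurable]: "a \<in> borel_measurable P" "b \<in> borel_measurable P"
    and \<theta>: "\<And>x. R *v \<theta> x = b x - a x" "integrable Q (\<lambda>x. (norm (\<theta> x))\<^sup>2)"
  shows "relative_entropy_le (distr (Q \<Otimes>\<^sub>M std_gaussian) (P \<Otimes>\<^sub>M borel) (\<lambda>(x, z). (x, b x + R *v z)))
     (distr (P \<Otimes>\<^sub>M std_gaussian) (P \<Otimes>\<^sub>M borel) (\<lambda>(x, z). (x, a x + R *v z)))
     (B + (\<integral>x. (norm (\<theta> x))\<^sup>2 \<partial>Q) / 2)"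
  unfolding relative_entropy_le_def
proof safe
  let ?G = "std_gaussian :: (real^'n) measure"
  fix \<phi> :: "'a \<times> (real^'n) \<Rightarrow> real" and c
  assume "\<phi> \<in> borel_measurable (distr (P \<Otimes>\<^sub>M ?G) (P \<Otimes>\<^sub>M borel) (\<lambda>(x, z). (x, a x + R *v z)))"
    and c: "\<forall>x. \<bar>\<phi> x\<bar> \<le> c"
  then have [measurable]: "\<phi> \<in> borel_measurable (P \<Otimes>\<^sub>M borel)" by simp
  interpret P: prob_space P by fact
  interpret Q: prob_space Q by fact
  interpret G: prob_space ?G by (rule prob_space_std_gaussian)
  interpret PG: pair_prob_space P ?G ..
  interpret QG: pair_prob_space Q ?G ..
  have [measurable]: "(\<lambda>z::real^'n. R *v z) \<in> borel_measurable borel"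
    by (intro borel_measurable_continuous_onI continuous_intros)
  have QP[measurable_cong]: "sets Q = sets P" by fact
  define \<psi>a where "\<psi>a x z = \<phi> (x, a x + R *v z)" for x z
  define \<psi>b where "\<psi>b x z = \<phi> (x, b x + R *v z)" for x z
  have [measurable]: "(\<lambda>(x,z). \<psi>a x z) \<in> borel_measurable (P \<Otimes>\<^sub>M borel)" "(\<lambda>(x,z). \<psi>b x z) \<in> borel_measurable (P \<Otimes>\<^sub>M borel)"
    unfolding \<psi>a_def \<psi>b_def by measurable
  have ca: "\<bar>\<psi>a x z\<bar> \<le> c" and cb: "\<bar>\<psi>b x z\<bar> \<le> c" for x z
    using c by (simp_all add: \<psi>a_def \<psi>b_def)
  define I where "I x = (\<integral>z. exp (\<psi>a x z) \<partial>?G)" for x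
  have [measurable]: "I \<in> borel_measurable P" unfolding I_def by measurable
  have ax[measurable]: "\<psi>a x \<in> borel_measurable borel" "\<psi>b x \<in> borel_measurable borel" if "x \<in> space P" for x
    using that by measurable
  \<comment> \<open>The two-sided bound keeps \<open>ln (I x)\<close> between \<open>- c\<close> and
    \<open>c\<close>, which makes it an admissible test function.\<close>
  have Ib: "exp (- c) \<le> I x" "I x \<le> exp c" if x: "x \<in> space P" for x
  proof -
    have i: "integrable ?G (\<lambda>z. exp (\<psi>a x z))"
      by (rule integrable_bounded_prob[OF prob_space_std_gaussian, of _ c]) (use x ca in auto)
    have "- c \<le> \<psi>a x z" "\<psi>a x z \<le> c" for z using ca[of x z] by linarith+
    then have "(\<integral>z. exp (- c) \<partial>?G) \<le> I x" "I x \<le> (\<integral>z. exp c \<partial>?G)"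
      unfolding I_def using i by (intro integral_mono; simp)+
    moreover have "G.prob UNIV = 1" using G.prob_space by simp
    ultimately show "exp (- c) \<le> I x" "I x \<le> exp c" by simp_all
  qed
  \<comment> \<open>integrating out the second coordinate turns \<open>\<phi>\<close> into a test function for \<open>Q\<close> and \<open>P\<close>\<close>
  define g where "g x = (if x \<in> space P then ln (I x) else 0)" for x
  have "0 \<le> c" using ca[of undefined undefined] by linarith
  have gm: "g \<in> borel_measurable P"
    by (subst measurable_cong[where g = "\<lambda>x. ln (I x)"]) (auto simp: g_def)
  \<comment> \<open>Test functions are bounded at every point, not just on the space of P; hence the
    default value 0 outside it.\<close>
  have gb: "\<bar>g x\<bar> \<le> c" for x
  proof (cases "x \<in> space P")
    case True
    have "0 < I x" using Ib(1)[OF True] less_le_trans[OF exp_gt_zero] by blast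
    then have "- c \<le> ln (I x)" "ln (I x) \<le> c"
      using Ib[OF True] ln_mono[of "I x" "exp c"] by (simp_all add: ln_ge_iff)
    then show ?thesis using True by (simp add: g_def abs_le_iff)
  qed (use \<open>0 \<le> c\<close> in \<open>simp add: g_def\<close>)
  have main: "(\<integral>x. g x \<partial>Q) + 1 \<le> (\<integral>x. exp (g x) \<partial>P) + B"
    by (rule relative_entropy_leD[OF le gm gb])
  have "(\<integral>x. exp (g x) \<partial>P) = (\<integral>x. I x \<partial>P)"
    by (intro Bochner_Integration.integral_cong refl)
      (auto simp: g_def intro: exp_ln less_le_trans[OF exp_gt_zero Ib(1)])
  also have "\<dots> = (\<integral>y. exp (\<phi> y) \<partial>distr (P \<Otimes>\<^sub>M ?G) (P \<Otimes>\<^sub>M borel) (\<lambda>(x, z). (x, a x + R *v z)))"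
  proof -
    have i: "integrable (P \<Otimes>\<^sub>M ?G) (\<lambda>y. exp (case_prod \<psi>a y))"
      by (rule integrable_bounded_prob[OF PG.prob_space_axioms, of _ c]) (auto simp: ca split: prod.split)
    show ?thesis
      using PG.integral_fst'[OF i] unfolding I_def \<psi>a_def
      by (subst integral_distr) (auto simp: case_prod_unfold)
  qed
  finally have 1: "(\<integral>x. exp (g x) \<partial>P) = (\<integral>y. exp (\<phi> y) \<partial>distr (P \<Otimes>\<^sub>M ?G) (P \<Otimes>\<^sub>M borel) (\<lambda>(x, z). (x, a x + R *v z)))" .
  have "(\<integral>y. \<phi> y \<partial>distr (Q \<Otimes>\<^sub>M ?G) (P \<Otimes>\<^sub>M borel) (\<lambda>(x, z). (x, b x + R *v z))) = (\<integral>x. (\<integral>z. \<psi>b x z \<partial>?G) \<partial>Q)"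
  proof -
    have i: "integrable (Q \<Otimes>\<^sub>M ?G) (case_prod \<psi>b)"
      by (rule integrable_bounded_prob[OF QG.prob_space_axioms, of _ c]) (auto simp: cb split: prod.split)
    show ?thesis
      using QG.integral_fst'[OF i] unfolding \<psi>b_def
      by (subst integral_distr) (auto simp: case_prod_unfold)
  qed
  also have "\<dots> \<le> (\<integral>x. g x + (norm (\<theta> x))\<^sup>2 / 2 \<partial>Q)"
  proof (rule integral_mono)
    have "\<bar>\<integral>z. \<psi>b x z \<partial>?G\<bar> \<le> c" if "x \<in> space P" for x
    proof -
      have i: "integrable ?G (\<psi>b x)"
        by (rule integrable_bounded_prob[OF prob_space_std_gaussian, of _ c]) (use that cb in auto)
      have "\<bar>\<integral>z. \<psi>b x z \<partial>?G\<bar> \<le> (\<integral>z. \<bar>\<psi>b x z\<bar> \<partial>?G)" by (rule integral_abs_bound)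
      also have "\<dots> \<le> (\<integral>z. c \<partial>?G)" using i cb by (intro integral_mono) auto
      finally show ?thesis using G.prob_space by simp
    qed
    then show "integrable Q (\<lambda>x. \<integral>z. \<psi>b x z \<partial>?G)"
      by (intro Q.integrable_const_bound[where B = c]) (auto simp: sets_eq_imp_space_eq[OF sets])
    have "g \<in> borel_measurable Q" using gm by (simp add: measurable_cong_sets[OF sets refl])
    then show "integrable Q (\<lambda>x. g x + (norm (\<theta> x))\<^sup>2 / 2)"
      by (intro Bochner_Integration.integrable_add integrable_divide_zero \<theta>(2) integrable_bounded_prob[OF Q _ gb])
    fix x assume "x \<in> space Q"
    then have x: "x \<in> space P" by (simp add: sets_eq_imp_space_eq[OF sets])
    have "\<psi>b x z = \<psi>a x (z + \<theta> x)" for z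
      by (simp add: \<psi>a_def \<psi>b_def matrix_vector_right_distrib \<theta>(1) add.commute)
    then show "(\<integral>z. \<psi>b x z \<partial>?G) \<le> g x + (norm (\<theta> x))\<^sup>2 / 2"
      using gaussian_variational[OF ax(1)[OF x] ca, of "\<theta> x"] x by (simp add: g_def I_def)
  qed
  also have "\<dots> = (\<integral>x. g x \<partial>Q) + (\<integral>x. (norm (\<theta> x))\<^sup>2 \<partial>Q) / 2"
  proof -
    have "g \<in> borel_measurable Q" using gm by (simp add: measurable_cong_sets[OF sets refl])
    then have "integrable Q g" by (rule integrable_bounded_prob[OF Q _ gb])
    then show ?thesis using \<theta>(2) by simp
  qed
  finally show "(\<integral>y. \<phi> y \<partial>distr (Q \<Otimes>\<^sub>M ?G) (P \<Otimes>\<^sub>M borel) (\<lambda>(x, z). (x, b x + R *v z))) + 1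
      \<le> (\<integral>y. exp (\<phi> y) \<partial>distr (P \<Otimes>\<^sub>M ?G) (P \<Otimes>\<^sub>M borel) (\<lambda>(x, z). (x, a x + R *v z)))
        + (B + (\<integral>x. (norm (\<theta> x))\<^sup>2 \<partial>Q) / 2)"
    using main unfolding 1 by linarith
qed

text \<open>Covers both chains: \<open>a k\<close> is the whole deterministic part of a step. The
  initial value has index 0 in the independent family, so \<open>\<xi> k\<close> has index
  \<open>Suc k\<close>.\<close>

locale gaussian_chain = prob_space M for M :: "'w measure" +
  fixes \<xi> :: "nat \<Rightarrow> 'w \<Rightarrow> real^'n" and X :: "nat \<Rightarrow> 'w \<Rightarrow> real^'n"
    and a :: "nat \<Rightarrow> real^'n \<Rightarrow> real^'n" and R :: "real^'n^'n"
  assumes distr_\<xi>: "\<And>k. distr M borel (\<xi> k) = std_gaussian"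
    and indep: "indep_vars (\<lambda>_. borel) (case_nat (X 0) \<xi>) UNIV"
    and a_measurable: "\<And>k. a k \<in> borel_measurable borel"
    and X_Suc: "\<And>k \<omega>. X (Suc k) \<omega> = a k (X k \<omega>) + R *v \<xi> k \<omega>"
begin

lemma R_measurable[measurable]: "(\<lambda>z::real^'n. R *v z) \<in> borel_measurable borel"
  by (intro borel_measurable_continuous_onI continuous_intros)

declare a_measurable[measurable]

text \<open>Exhibits \<open>X k\<close> as a measurable function of the driving variables with
  indices up to \<open>k\<close>, so that independence can be read off from disjoint index
  sets.\<close>

primrec state :: "nat \<Rightarrow> (nat \<Rightarrow> real^'n) \<Rightarrow> real^'n" where
  "state 0 y = y 0"
| "state (Suc k) y = a k (state k y) + R *v y (Suc k)"

lemma state_measurable: "k \<le> m \<Longrightarrow> state k \<in> borel_measurable (\<Pi>\<^sub>M j\<in>{..m}. borel)"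
proof (induction k)
  case 0
  have "(\<lambda>y. y 0) \<in> borel_measurable (\<Pi>\<^sub>M j\<in>{..m}. borel :: (real^'n) measure)"
    by (rule measurable_component_singleton) simp
  then show ?case by (simp cong: measurable_cong)
next
  case (Suc k)
  then have [measurable]: "state k \<in> borel_measurable (\<Pi>\<^sub>M j\<in>{..m}. borel)" by simp
  have [measurable]: "(\<lambda>y. y (Suc k)) \<in> borel_measurable (\<Pi>\<^sub>M j\<in>{..m}. borel :: (real^'n) measure)"
    by (rule measurable_component_singleton) (use Suc in simp)
  have "(\<lambda>y. a k (state k y) + R *v y (Suc k)) \<in> borel_measurable (\<Pi>\<^sub>M j\<in>{..m}. borel)" by measurable
  then show ?case by (simp cong: measurable_cong)
qed

lemma X_eq_state: "k \<le> m \<Longrightarrow> X k \<omega> = state k (\<lambda>j\<in>{..m}. case_nat (X 0) \<xi> j \<omega>)"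
  by (induction k) (simp_all add: X_Suc)

lemma noise_measurable: "case_nat (X 0) \<xi> i \<in> borel_measurable M"
  using indep unfolding indep_vars_def by simp

lemma \<xi>_measurable[measurable]: "\<xi> k \<in> borel_measurable M"
  using noise_measurable[of "Suc k"] by simp

lemma X_measurable[measurable]: "X k \<in> borel_measurable M"
proof (induction k)
  case 0
  then show ?case using noise_measurable[of 0] by simp
next
  case (Suc k)
  then have "(\<lambda>\<omega>. a k (X k \<omega>) + R *v \<xi> k \<omega>) \<in> borel_measurable M" by measurable
  then show ?case by (subst measurable_cong[OF X_Suc])
qed

lemma path_measurable[measurable]:
  "(\<lambda>\<omega>. \<lambda>j\<in>{..k}. X j \<omega>) \<in> measurable M (\<Pi>\<^sub>M j\<in>{..k}. borel)"
  by (rule measurable_restrict) simp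

lemma prob_space_path_law: "prob_space (path_law M X k)"
  unfolding path_law_def by (rule prob_space_distr) simp

lemma sets_path_law: "sets (path_law M X k) = sets (\<Pi>\<^sub>M j\<in>{..k}. borel)"
  by (simp add: path_law_def)

text \<open>The path up to \<open>k\<close> uses the indices up to \<open>k\<close>, while
  \<open>\<xi> k\<close> has index \<open>Suc k\<close>. The blocks are disjoint, hence independent,
  and the joint law is a product.\<close>

lemma path_joint:
  "path_law M X k \<Otimes>\<^sub>M std_gaussian
    = distr M ((\<Pi>\<^sub>M j\<in>{..k}. borel) \<Otimes>\<^sub>M borel) (\<lambda>\<omega>. (\<lambda>j\<in>{..k}. X j \<omega>, \<xi> k \<omega>))"
proof -
  \<comment> \<open>The block of driving variables indexed by \<open>A\<close>. Because of the shift
    in \<open>case_nat\<close>, the block \<open>{..k}\<close> contains \<open>X 0\<close> and the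
    noises before \<open>\<xi> k\<close>.\<close>
  let ?Y = "\<lambda>A \<omega>. \<lambda>j\<in>A. case_nat (X 0) \<xi> j \<omega>"
  let ?N = "\<lambda>A. \<Pi>\<^sub>M j\<in>A. borel :: (real^'n) measure"
  let ?f = "\<lambda>y. \<lambda>j\<in>{..k}. state j y" and ?g = "\<lambda>y. y (Suc k)"
  have "indep_var (?N {..k}) (?Y {..k}) (?N {Suc k}) (?Y {Suc k})"
    by (rule indep_var_restrict[OF indep]) auto
  then have Y[measurable]: "?Y {..k} \<in> measurable M (?N {..k})" "?Y {Suc k} \<in> measurable M (?N {Suc k})"
    and joint: "distr M (?N {..k}) (?Y {..k}) \<Otimes>\<^sub>M distr M (?N {Suc k}) (?Y {Suc k})
      = distr M (?N {..k} \<Otimes>\<^sub>M ?N {Suc k}) (\<lambda>\<omega>. (?Y {..k} \<omega>, ?Y {Suc k} \<omega>))"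
    unfolding indep_var_distribution_eq by blast+
  have f[measurable]: "?f \<in> measurable (?N {..k}) (?N {..k})"
    by (rule measurable_restrict) (simp add: state_measurable)
  have g[measurable]: "?g \<in> borel_measurable (?N {Suc k})"
    by (rule measurable_component_singleton) simp
  have fX: "?f (?Y {..k} \<omega>) = (\<lambda>j\<in>{..k}. X j \<omega>)" for \<omega>
    by (auto simp: fun_eq_iff X_eq_state[of _ k] restrict_def)
  have "path_law M X k = distr (distr M (?N {..k}) (?Y {..k})) (?N {..k}) ?f"
    unfolding path_law_def by (subst distr_distr[OF f Y(1)]) (simp add: comp_def fX)
  moreover have "std_gaussian = distr (distr M (?N {Suc k}) (?Y {Suc k})) borel ?g"
    unfolding distr_\<xi>[of k, symmetric] by (subst distr_distr[OF g Y(2)]) (simp add: comp_def)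
  ultimately have "path_law M X k \<Otimes>\<^sub>M std_gaussian
    = distr (distr M (?N {..k}) (?Y {..k})) (?N {..k}) ?f \<Otimes>\<^sub>M distr (distr M (?N {Suc k}) (?Y {Suc k})) borel ?g"
    by simp
  also have "\<dots> = distr (distr M (?N {..k}) (?Y {..k}) \<Otimes>\<^sub>M distr M (?N {Suc k}) (?Y {Suc k}))
      (?N {..k} \<Otimes>\<^sub>M borel) (\<lambda>(x, y). (?f x, ?g y))"
  proof (rule pair_measure_distr)
    have "prob_space (distr (distr M (?N {Suc k}) (?Y {Suc k})) borel ?g)"
      by (intro prob_space.prob_space_distr prob_space_distr Y) simp
    then show "sigma_finite_measure (distr (distr M (?N {Suc k}) (?Y {Suc k})) borel ?g)"
      by (rule prob_space_imp_sigma_finite)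
  qed simp_all
  also have "\<dots> = distr M (?N {..k} \<Otimes>\<^sub>M borel) (\<lambda>\<omega>. (\<lambda>j\<in>{..k}. X j \<omega>, \<xi> k \<omega>))"
    unfolding joint by (subst distr_distr) (auto simp: comp_def fX)
  finally show ?thesis .
qed

text \<open>Splits the extension of a path into the noise step treated by
  \<open>relative_entropy_le_step\<close> and a relabelling treated by
  \<open>relative_entropy_le_distr\<close>.\<close>

lemma path_law_Suc:
  "path_law M X (Suc k) = distr
     (distr (path_law M X k \<Otimes>\<^sub>M std_gaussian) ((\<Pi>\<^sub>M j\<in>{..k}. borel) \<Otimes>\<^sub>M borel) (\<lambda>(x, z). (x, a k (x k) + R *v z)))
     (\<Pi>\<^sub>M j\<in>{..Suc k}. borel) (\<lambda>(x, y). x(Suc k := y))"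
proof -
  let ?N = "\<Pi>\<^sub>M j\<in>{..k}. borel :: (real^'n) measure"
  let ?p = "\<lambda>\<omega>. \<lambda>j\<in>{..k}. X j \<omega>"
  have joint: "path_law M X k \<Otimes>\<^sub>M std_gaussian = distr M (?N \<Otimes>\<^sub>M borel) (\<lambda>\<omega>. (?p \<omega>, \<xi> k \<omega>))"
    by (rule path_joint)
  have [measurable]: "(\<lambda>x. x k) \<in> borel_measurable ?N" by (rule measurable_component_singleton) simp
  have up[measurable]: "(\<lambda>(x, y). x(Suc k := y)) \<in> measurable (?N \<Otimes>\<^sub>M borel) (\<Pi>\<^sub>M j\<in>{..Suc k}. borel)"
    using measurable_add_dim[of "Suc k" "{..k}" "\<lambda>_. borel :: (real^'n) measure"] by (simp add: atMost_Suc)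
  have step[measurable]: "(\<lambda>(x, z). (x, a k (x k) + R *v z)) \<in> measurable (?N \<Otimes>\<^sub>M borel) (?N \<Otimes>\<^sub>M borel)" by measurable
  have pm: "(\<lambda>\<omega>. (?p \<omega>, \<xi> k \<omega>)) \<in> measurable M (?N \<Otimes>\<^sub>M borel)" by measurable
  show ?thesis
    unfolding joint distr_distr[OF step pm] distr_distr[OF up measurable_comp[OF pm step]]
    unfolding path_law_def
    by (rule distr_cong) (auto simp: fun_eq_iff X_Suc le_Suc_eq)
qed

lemma path_law_0: "path_law M X 0 = distr (distr M borel (X 0)) (\<Pi>\<^sub>M j\<in>{..0}. borel) (\<lambda>x. \<lambda>j\<in>{..0}. x)"
proof -
  have m: "(\<lambda>x. \<lambda>j\<in>{..0}. x) \<in> measurable borel (\<Pi>\<^sub>M j\<in>{..0::nat}. borel :: (real^'n) measure)"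
    by (rule measurable_restrict) simp
  show ?thesis unfolding path_law_def
    by (subst distr_distr[OF m X_measurable]) (auto intro!: distr_cong simp: fun_eq_iff)
qed

lemma distr_X_eq: "distr M borel (X k) = distr (path_law M X k) borel (\<lambda>x. x k)"
proof -
  have m: "(\<lambda>x. x k) \<in> borel_measurable (\<Pi>\<^sub>M j\<in>{..k}. borel :: (real^'n) measure)"
    by (rule measurable_component_singleton) simp
  show ?thesis unfolding path_law_def
    by (subst distr_distr[OF m path_measurable]) (auto intro!: distr_cong)
qed

end

text \<open>The step costs add up by induction. Each is an expectation along \<open>Y\<close>, the
  chain whose law is the first argument of the divergence.\<close>

lemma relative_entropy_le_path_law:
  fixes X Y :: "nat \<Rightarrow> 'w \<Rightarrow> real^'n"
  assumes X: "gaussian_chain M \<xi> X a R" and Y: "gaussian_chain M \<xi> Y b R"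
    and init: "relative_entropy_le (distr M borel (Y 0)) (distr M borel (X 0)) B"
    and \<theta>m: "\<And>k. \<theta> k \<in> borel_measurable borel" and \<theta>: "\<And>k x. R *v \<theta> k x = b k x - a k x"
    and cost: "\<And>j. j < k \<Longrightarrow> integrable M (\<lambda>\<omega>. (norm (\<theta> j (Y j \<omega>)))\<^sup>2)"
  shows "relative_entropy_le (path_law M Y k) (path_law M X k) (B + (\<Sum>j<k. (\<integral>\<omega>. (norm (\<theta> j (Y j \<omega>)))\<^sup>2 \<partial>M) / 2))"
  using cost
proof (induction k)
  interpret X: gaussian_chain M \<xi> X a R by fact
  interpret Y: gaussian_chain M \<xi> Y b R by fact
  case 0
  have m: "(\<lambda>x. \<lambda>j\<in>{..0}. x) \<in> measurable (distr M borel (X 0)) (\<Pi>\<^sub>M j\<in>{..0::nat}. borel :: (real^'n) measure)"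
    by (subst measurable_distr_eq1) (rule measurable_restrict, simp)
  show ?case
    unfolding X.path_law_0 Y.path_law_0 using relative_entropy_le_distr[OF init _ m] by (simp del: atMost_0)
next
  interpret X: gaussian_chain M \<xi> X a R by fact
  interpret Y: gaussian_chain M \<xi> Y b R by fact
  case (Suc k)
  let ?N = "\<Pi>\<^sub>M j\<in>{..k}. borel :: (real^'n) measure"
  let ?P = "path_law M X k" and ?Q = "path_law M Y k"
  have [measurable]: "(\<lambda>x. x k) \<in> borel_measurable ?N" by (rule measurable_component_singleton) simp
  note \<theta>m[measurable] X.a_measurable[measurable] Y.a_measurable[measurable]
  have [measurable_cong]: "sets ?P = sets ?N" "sets ?Q = sets ?N"
    by (rule X.sets_path_law Y.sets_path_law)+
  have th: "integrable ?Q (\<lambda>x. (norm (\<theta> k (x k)))\<^sup>2)"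
    "(\<integral>x. (norm (\<theta> k (x k)))\<^sup>2 \<partial>?Q) = (\<integral>\<omega>. (norm (\<theta> k (Y k \<omega>)))\<^sup>2 \<partial>M)"
    unfolding path_law_def using Suc.prems[of k]
    by (subst integrable_distr_eq integral_distr; simp)+
  have "relative_entropy_le (distr (?Q \<Otimes>\<^sub>M std_gaussian) (?P \<Otimes>\<^sub>M borel) (\<lambda>(x, z). (x, b k (x k) + R *v z)))
     (distr (?P \<Otimes>\<^sub>M std_gaussian) (?P \<Otimes>\<^sub>M borel) (\<lambda>(x, z). (x, a k (x k) + R *v z)))
     (B + (\<Sum>j<k. (\<integral>\<omega>. (norm (\<theta> j (Y j \<omega>)))\<^sup>2 \<partial>M) / 2) + (\<integral>x. (norm (\<theta> k (x k)))\<^sup>2 \<partial>?Q) / 2)"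
    by (rule relative_entropy_le_step[OF X.prob_space_path_law Y.prob_space_path_law _ Suc.IH, where \<theta> = "\<lambda>x. \<theta> k (x k)"])
      (use Suc.prems th in \<open>auto simp: X.sets_path_law Y.sets_path_law \<theta>\<close>)
  \<comment> \<open>\<open>path_law\<close> carries the product sigma-algebra, so the target space
    can be rewritten into the shape required by \<open>path_law_Suc\<close>.\<close>
  moreover have "sets (?P \<Otimes>\<^sub>M (borel :: (real^'n) measure)) = sets (?N \<Otimes>\<^sub>M borel)"
    by (intro sets_pair_measure_cong X.sets_path_law refl)
  then have "distr L (?P \<Otimes>\<^sub>M borel) g = distr L (?N \<Otimes>\<^sub>M borel) g" for L and g :: "(nat \<Rightarrow> real^'n) \<times> (real^'n) \<Rightarrow> (nat \<Rightarrow> real^'n) \<times> (real^'n)"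
    by (intro distr_cong) auto
  ultimately have "relative_entropy_le (distr (?Q \<Otimes>\<^sub>M std_gaussian) (?N \<Otimes>\<^sub>M borel) (\<lambda>(x, z). (x, b k (x k) + R *v z)))
     (distr (?P \<Otimes>\<^sub>M std_gaussian) (?N \<Otimes>\<^sub>M borel) (\<lambda>(x, z). (x, a k (x k) + R *v z)))
     (B + (\<Sum>j<Suc k. (\<integral>\<omega>. (norm (\<theta> j (Y j \<omega>)))\<^sup>2 \<partial>M) / 2))"
    by (simp add: th(2) add.assoc)
  then show ?case
    unfolding X.path_law_Suc Y.path_law_Suc
    using measurable_add_dim[of "Suc k" "{..k}" "\<lambda>_. borel :: (real^'n) measure"]
    by (intro relative_entropy_le_distr) (auto simp: atMost_Suc)
qed

section \<open>Moments and cost of the linearized chain\<close>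

text \<open>The factor \<open>sqrt c\<close> comes out of the norm identity, with no appeal to
  uniqueness of the root or to how roots scale.\<close>

lemma matrix_sqrt_scaleR_bound:
  fixes A :: "real^'n^'n"
  assumes "pos_semidef A"
  obtains K where "0 \<le> K" "\<And>c x. 0 \<le> c \<Longrightarrow> norm (matrix_sqrt (c *\<^sub>R A) *v x) \<le> sqrt c * K * norm x"
proof -
  obtain K where K: "0 < K" "\<And>x. norm (A *v x) \<le> K * norm x" by (rule matrix_vector_mult_bound[of A]) blast
  show thesis
  proof (rule that[of "sqrt K"])
    fix c :: real and x assume c: "0 \<le> c"
    have "(norm (matrix_sqrt (c *\<^sub>R A) *v x))\<^sup>2 = c * (x \<bullet> (A *v x))"
      using norm_matrix_sqrt[OF pos_semidef_scaleR[OF assms c]] by (simp add: scaleR_matrix_vector_assoc[symmetric])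
    also have "\<dots> \<le> c * (norm x * (K * norm x))"
      using c K(2) by (intro mult_left_mono order_trans[OF norm_cauchy_schwarz]) auto
    also have "\<dots> = (sqrt c * sqrt K * norm x)\<^sup>2"
      using c K(1) by (simp add: power_mult_distrib) (simp add: power2_eq_square)
    finally have le: "(norm (matrix_sqrt (c *\<^sub>R A) *v x))\<^sup>2 \<le> (sqrt c * sqrt K * norm x)\<^sup>2" .
    have "0 \<le> sqrt c * sqrt K * norm x" using c K(1) by (intro mult_nonneg_nonneg) auto
    from power2_le_imp_le[OF le this]
    show "norm (matrix_sqrt (c *\<^sub>R A) *v x) \<le> sqrt c * sqrt K * norm x" .
  qed (use K in simp)
qed

lemma pos_def_scaleR: "pos_def A \<Longrightarrow> 0 < c \<Longrightarrow> pos_def (c *\<^sub>R A)"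
  using pos_semidef_scaleR[OF pos_def_imp_pos_semidef, of A c]
  unfolding pos_def_def pos_semidef_def by (auto simp: scaleR_matrix_vector_assoc[symmetric])

text \<open>By the norm identity a vector in the kernel of the root annihilates the quadratic form
  of \<open>A\<close>, hence is zero.\<close>

lemma matrix_sqrt_inverse:
  fixes A :: "real^'n^'n"
  assumes "pos_def A"
  shows "matrix_sqrt A *v (matrix_inv (matrix_sqrt A) *v y) = y"
proof -
  let ?R = "matrix_sqrt A"
  have "x = 0" if "?R *v x = 0" for x
    using norm_matrix_sqrt[OF pos_def_imp_pos_semidef[OF assms], of x] that assms by (auto simp: pos_def_def)
  then have "invertible ?R"
    unfolding invertible_left_inverse matrix_left_invertible_ker by blast
  then have "?R ** matrix_inv ?R = mat 1"
    unfolding invertible_def matrix_inv_def by (rule someI2_ex) simp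
  then show ?thesis by (simp add: matrix_vector_mul_assoc)
qed

text \<open>As \<open>gaussian\<close> is a pushforward, the moments are computed under the standard
  Gaussian and a singular \<open>C0\<close> needs no separate treatment. The constant is chosen
  before \<open>\<epsilon>\<close>.\<close>

lemma gaussian_centered_moments:
  fixes C0 :: "real^'n^'n"
  assumes "pos_semidef C0"
  shows "\<exists>C\<ge>0. \<forall>\<epsilon>>0. integrable (gaussian m (\<epsilon> *\<^sub>R C0)) (\<lambda>x. norm (x - m) ^ p)
    \<and> (\<integral>x. norm (x - m) ^ p \<partial>gaussian m (\<epsilon> *\<^sub>R C0)) \<le> C * sqrt \<epsilon> ^ p"
proof -
  let ?G = "std_gaussian :: (real^'n) measure"
  define G where "G = (\<integral>x. norm x ^ p \<partial>?G)"
  have G0: "0 \<le> G" by (simp add: G_def)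
  have iG: "integrable ?G (\<lambda>x. norm x ^ p)" by (rule integrable_norm_power_std_gaussian)
  obtain K where K: "0 \<le> K" "\<And>c x. 0 \<le> c \<Longrightarrow> norm (matrix_sqrt (c *\<^sub>R C0) *v x) \<le> sqrt c * K * norm x"
    by (rule matrix_sqrt_scaleR_bound[OF assms]) blast
  show ?thesis
  proof (intro exI conjI allI impI)
    show "0 \<le> K ^ p * G" using K(1) G0 by simp
    fix \<epsilon> :: real assume \<epsilon>: "0 < \<epsilon>"
    let ?R = "matrix_sqrt (\<epsilon> *\<^sub>R C0)"
    have Rm: "(\<lambda>x. m + ?R *v x) \<in> borel_measurable ?G"
      unfolding measurable_cong_sets[OF sets_std_gaussian refl]
      by (intro borel_measurable_continuous_onI continuous_intros)
    have Nm: "(\<lambda>x. norm (x - m) ^ p) \<in> borel_measurable borel" by measurable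
    have Nm': "(\<lambda>x. norm (?R *v x) ^ p) \<in> borel_measurable ?G"
      unfolding measurable_cong_sets[OF sets_std_gaussian refl]
      by (intro borel_measurable_continuous_onI continuous_intros)
    have bd: "norm (?R *v x) ^ p \<le> (sqrt \<epsilon> * K) ^ p * norm x ^ p" for x
      unfolding power_mult_distrib[symmetric] using \<epsilon> by (intro power_mono K(2)) auto
    have iB: "integrable ?G (\<lambda>x. (sqrt \<epsilon> * K) ^ p * norm x ^ p)" by (intro integrable_mult_right iG)
    have iR: "integrable ?G (\<lambda>x. norm (?R *v x) ^ p)"
    proof (rule Bochner_Integration.integrable_bound[OF iB Nm'], rule AE_I2)
      show "norm (norm (?R *v x) ^ p) \<le> norm ((sqrt \<epsilon> * K) ^ p * norm x ^ p)" for x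
        using order_trans[OF bd[of x] abs_ge_self] by simp
    qed
    then show "integrable (gaussian m (\<epsilon> *\<^sub>R C0)) (\<lambda>x. norm (x - m) ^ p)"
      unfolding gaussian_def by (subst integrable_distr_eq[OF Rm Nm]) simp
    have "(\<integral>x. norm (x - m) ^ p \<partial>gaussian m (\<epsilon> *\<^sub>R C0)) = (\<integral>x. norm (?R *v x) ^ p \<partial>?G)"
      unfolding gaussian_def by (subst integral_distr[OF Rm Nm]) simp
    also have "\<dots> \<le> (\<integral>x. (sqrt \<epsilon> * K) ^ p * norm x ^ p \<partial>?G)"
      by (rule integral_mono[OF iR iB bd])
    also have "\<dots> = K ^ p * G * sqrt \<epsilon> ^ p" by (simp add: G_def power_mult_distrib)
    finally show "(\<integral>x. norm (x - m) ^ p \<partial>gaussian m (\<epsilon> *\<^sub>R C0)) \<le> K ^ p * G * sqrt \<epsilon> ^ p" .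
  qed
qed

section \<open>Deviation of the linearized chain from the Euler mean, and its entropy cost\<close>

definition linearized_drift :: "(real^'n \<Rightarrow> real^'n) \<Rightarrow> real \<Rightarrow> real^'n \<Rightarrow> real^'n \<Rightarrow> real^'n" where
  "linearized_drift f h m x = x + h *\<^sub>R (f m + jacobian f (at m) *v (x - m))"

context
  fixes f :: "real^'n \<Rightarrow> real^'n" and T h :: real and S C0 :: "real^'n^'n" and m0 :: "real^'n"
    and M :: "'w measure" and \<xi> :: "nat \<Rightarrow> 'w \<Rightarrow> real^'n" and l0 :: "real \<Rightarrow> 'w \<Rightarrow> real^'n"
  assumes f: "standing_assumption f T" and S: "pos_def S" and C0: "pos_semidef C0" and h: "0 < h"
    and l0: "\<And>\<epsilon>. \<epsilon> > 0 \<Longrightarrow> distr M borel (l0 \<epsilon>) = gaussian m0 (\<epsilon> *\<^sub>R C0)"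
    and chain: "\<And>\<epsilon>. \<epsilon> > 0 \<Longrightarrow> gaussian_chain M \<xi> (linearized_chain f S \<epsilon> h m0 \<xi> (l0 \<epsilon>))
      (\<lambda>k. linearized_drift f h (euler_mean f h m0 k)) (matrix_sqrt ((\<epsilon> * h) *\<^sub>R S))"
begin

text \<open>In the difference of the two recursions \<open>f m\<close> cancels, leaving a linear
  recursion for the deviation with noise of order \<open>sqrt \<epsilon>\<close>. The constant may
  grow with \<open>k\<close> and \<open>p\<close> but not with \<open>\<epsilon>\<close>.\<close>

lemma linearized_chain_moments:
  "\<exists>C\<ge>0. \<forall>\<epsilon>>0. integrable M (\<lambda>\<omega>. norm (linearized_chain f S \<epsilon> h m0 \<xi> (l0 \<epsilon>) k \<omega> - euler_mean f h m0 k) ^ p)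
    \<and> (\<integral>\<omega>. norm (linearized_chain f S \<epsilon> h m0 \<xi> (l0 \<epsilon>) k \<omega> - euler_mean f h m0 k) ^ p \<partial>M) \<le> C * sqrt \<epsilon> ^ p"
proof (induction k)
  case 0
  obtain C where C: "0 \<le> C" "\<forall>\<epsilon>>0. integrable (gaussian m0 (\<epsilon> *\<^sub>R C0)) (\<lambda>x. norm (x - m0) ^ p)
    \<and> (\<integral>x. norm (x - m0) ^ p \<partial>gaussian m0 (\<epsilon> *\<^sub>R C0)) \<le> C * sqrt \<epsilon> ^ p"
    using gaussian_centered_moments[OF C0, of m0 p] by (elim exE conjE) (rule that)
  have Nm: "(\<lambda>x. norm (x - m0) ^ p) \<in> borel_measurable borel" by measurable
  show ?case
  proof (intro exI[of _ C] conjI C(1) allI impI)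
    fix \<epsilon> :: real assume \<epsilon>: "0 < \<epsilon>"
    have l0m: "l0 \<epsilon> \<in> borel_measurable M" using gaussian_chain.X_measurable[OF chain[OF \<epsilon>], of 0] by simp
    note C\<epsilon> = C(2)[rule_format, OF \<epsilon>, folded l0[OF \<epsilon>]]
    show "integrable M (\<lambda>\<omega>. norm (linearized_chain f S \<epsilon> h m0 \<xi> (l0 \<epsilon>) 0 \<omega> - euler_mean f h m0 0) ^ p)"
      using C\<epsilon>[THEN conjunct1] integrable_distr_eq[OF l0m Nm] by simp
    show "(\<integral>\<omega>. norm (linearized_chain f S \<epsilon> h m0 \<xi> (l0 \<epsilon>) 0 \<omega> - euler_mean f h m0 0) ^ p \<partial>M) \<le> C * sqrt \<epsilon> ^ p"
      using C\<epsilon>[THEN conjunct2] integral_distr[OF l0m Nm] by simp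
  qed
next
  case (Suc k)
  let ?G = "std_gaussian :: (real^'n) measure"
  define G where "G = (\<integral>x. norm x ^ p \<partial>?G)"
  have G0: "0 \<le> G" by (simp add: G_def)
  have iG: "integrable ?G (\<lambda>x. norm x ^ p)" by (rule integrable_norm_power_std_gaussian)
  define m where "m = euler_mean f h m0 k"
  define l where "l \<epsilon> = linearized_chain f S \<epsilon> h m0 \<xi> (l0 \<epsilon>) k" for \<epsilon>
  have "\<exists>C\<ge>0. \<forall>\<epsilon>>0. integrable M (\<lambda>\<omega>. norm (l \<epsilon> \<omega> - m) ^ p)
    \<and> (\<integral>\<omega>. norm (l \<epsilon> \<omega> - m) ^ p \<partial>M) \<le> C * sqrt \<epsilon> ^ p"
    unfolding l_def m_def by (rule Suc)
  then obtain C where C: "0 \<le> C" "\<forall>\<epsilon>>0. integrable M (\<lambda>\<omega>. norm (l \<epsilon> \<omega> - m) ^ p)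
    \<and> (\<integral>\<omega>. norm (l \<epsilon> \<omega> - m) ^ p \<partial>M) \<le> C * sqrt \<epsilon> ^ p"
    by (elim exE conjE) (rule that)
  obtain K where K: "0 \<le> K" "\<And>c x. 0 \<le> c \<Longrightarrow> norm (matrix_sqrt (c *\<^sub>R S) *v x) \<le> sqrt c * K * norm x"
    by (rule matrix_sqrt_scaleR_bound[OF pos_def_imp_pos_semidef[OF S]]) blast
  obtain J where J: "0 < J" "\<And>x. norm (jacobian f (at m) *v x) \<le> J * norm x"
    by (rule matrix_vector_mult_bound[of "jacobian f (at m)"]) blast
  \<comment> \<open>\<open>A\<close> bounds the norm of the identity plus \<open>h\<close> times the
    Jacobian; \<open>K'\<close> bounds the noise matrix once \<open>sqrt \<epsilon>\<close> is
    factored out.\<close>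
  define A where "A = 1 + h * J"
  define K' where "K' = sqrt h * K"
  have pos: "0 \<le> A" "0 \<le> K'" using J K h by (simp_all add: A_def K'_def)
  show ?case
  proof (intro exI conjI allI impI)
    show "0 \<le> 2 ^ p * (A ^ p * C + K' ^ p * G)" using pos C(1) G0 by simp
    fix \<epsilon> :: real assume \<epsilon>: "0 < \<epsilon>"
    interpret L: gaussian_chain M \<xi> "linearized_chain f S \<epsilon> h m0 \<xi> (l0 \<epsilon>)"
      "\<lambda>k. linearized_drift f h (euler_mean f h m0 k)" "matrix_sqrt ((\<epsilon> * h) *\<^sub>R S)" by (rule chain[OF \<epsilon>])
    note C\<epsilon> = C(2)[rule_format, OF \<epsilon>]
    let ?R = "matrix_sqrt ((\<epsilon> * h) *\<^sub>R S)"
    define X where "X \<omega> = linearized_chain f S \<epsilon> h m0 \<xi> (l0 \<epsilon>) (Suc k) \<omega> - euler_mean f h m0 (Suc k)" for \<omega>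
    let ?B = "\<lambda>\<omega>. 2 ^ p * (A ^ p * norm (l \<epsilon> \<omega> - m) ^ p + (K' * sqrt \<epsilon>) ^ p * norm (\<xi> k \<omega>) ^ p)"
    have Nm: "(\<lambda>x. norm x ^ p) \<in> borel_measurable (borel :: (real^'n) measure)" by measurable
    have i\<xi>: "integrable M (\<lambda>\<omega>. norm (\<xi> k \<omega>) ^ p)"
      using iG integrable_distr_eq[OF L.\<xi>_measurable Nm, of k] unfolding L.distr_\<xi> by simp
    have E\<xi>: "(\<integral>\<omega>. norm (\<xi> k \<omega>) ^ p \<partial>M) = G"
      using integral_distr[OF L.\<xi>_measurable Nm, of k] unfolding L.distr_\<xi> G_def by simp
    have bd: "norm (X \<omega>) ^ p \<le> ?B \<omega>" for \<omega>
    proof -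
      define e where "e = l \<epsilon> \<omega> - m"
      have "X \<omega> = e + h *\<^sub>R (jacobian f (at m) *v e) + ?R *v \<xi> k \<omega>"
        by (simp add: X_def e_def l_def m_def Let_def scaleR_add_right)
      also have "norm \<dots> \<le> norm e + norm (h *\<^sub>R (jacobian f (at m) *v e)) + norm (?R *v \<xi> k \<omega>)"
        by (rule order_trans[OF norm_triangle_ineq add_right_mono[OF norm_triangle_ineq]])
      also have "\<dots> \<le> norm e + h * (J * norm e) + sqrt (\<epsilon> * h) * K * norm (\<xi> k \<omega>)"
      proof (intro add_mono order_refl)
        show "norm (h *\<^sub>R (jacobian f (at m) *v e)) \<le> h * (J * norm e)"
          using mult_left_mono[OF J(2)[of e], of h] h by simp
        show "norm (?R *v \<xi> k \<omega>) \<le> sqrt (\<epsilon> * h) * K * norm (\<xi> k \<omega>)"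
          by (rule K(2)) (use \<epsilon> h in simp)
      qed
      also have "\<dots> = A * norm e + K' * sqrt \<epsilon> * norm (\<xi> k \<omega>)"
        by (simp add: A_def K'_def real_sqrt_mult algebra_simps)
      finally have "norm (X \<omega>) ^ p \<le> (A * norm e + K' * sqrt \<epsilon> * norm (\<xi> k \<omega>)) ^ p"
        by (rule power_mono) simp
      also have "\<dots> \<le> 2 ^ p * ((A * norm e) ^ p + (K' * sqrt \<epsilon> * norm (\<xi> k \<omega>)) ^ p)"
        by (rule add_power_le) (use pos \<epsilon> in simp_all)
      finally show ?thesis by (simp add: power_mult_distrib e_def)
    qed
    have iB: "integrable M ?B"
      by (intro integrable_mult_right Bochner_Integration.integrable_add C\<epsilon>[THEN conjunct1] i\<xi>)
    have "X \<in> borel_measurable M"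
      unfolding X_def[abs_def] by (intro borel_measurable_diff L.X_measurable measurable_const) simp
    then have Xm: "(\<lambda>\<omega>. norm (X \<omega>) ^ p) \<in> borel_measurable M" by measurable
    have iX: "integrable M (\<lambda>\<omega>. norm (X \<omega>) ^ p)"
    proof (rule Bochner_Integration.integrable_bound[OF iB Xm], rule AE_I2)
      show "norm (norm (X \<omega>) ^ p) \<le> norm (?B \<omega>)" for \<omega>
        using order_trans[OF bd[of \<omega>] abs_ge_self] by simp
    qed
    then show "integrable M (\<lambda>\<omega>. norm (linearized_chain f S \<epsilon> h m0 \<xi> (l0 \<epsilon>) (Suc k) \<omega> - euler_mean f h m0 (Suc k)) ^ p)"
      unfolding X_def .
    have "(\<integral>\<omega>. norm (X \<omega>) ^ p \<partial>M) \<le> (\<integral>\<omega>. ?B \<omega> \<partial>M)" by (rule integral_mono[OF iX iB bd])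
    also have "\<dots> = 2 ^ p * (A ^ p * (\<integral>\<omega>. norm (l \<epsilon> \<omega> - m) ^ p \<partial>M) + (K' * sqrt \<epsilon>) ^ p * G)"
      using C\<epsilon>[THEN conjunct1] i\<xi> by (simp add: E\<xi>)
    also have "\<dots> \<le> 2 ^ p * (A ^ p * (C * sqrt \<epsilon> ^ p) + (K' * sqrt \<epsilon>) ^ p * G)"
      by (intro mult_left_mono add_right_mono C\<epsilon>[THEN conjunct2]) (use pos in simp_all)
    also have "\<dots> = 2 ^ p * (A ^ p * C + K' ^ p * G) * sqrt \<epsilon> ^ p"
      by (simp add: power_mult_distrib algebra_simps)
    finally show "(\<integral>\<omega>. norm (linearized_chain f S \<epsilon> h m0 \<xi> (l0 \<epsilon>) (Suc k) \<omega> - euler_mean f h m0 (Suc k)) ^ p \<partial>M)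
        \<le> 2 ^ p * (A ^ p * C + K' ^ p * G) * sqrt \<epsilon> ^ p"
      unfolding X_def .
  qed
qed

text \<open>Squaring the Taylor remainder brings in the moments of orders 4 and
  \<open>4 + 2 * s\<close>, both of size at most a multiple of \<open>\<epsilon>^2\<close>; undoing
  the noise matrix costs one factor \<open>1 / \<epsilon>\<close>.\<close>

lemma drift_difference_cost:
  "\<exists>C\<ge>0. \<forall>\<epsilon>. 0 < \<epsilon> \<and> \<epsilon> < 1 \<longrightarrow>
    (let \<theta> = (\<lambda>x. matrix_inv (matrix_sqrt ((\<epsilon> * h) *\<^sub>R S)) *v (linearized_drift f h (euler_mean f h m0 k) x - (x + h *\<^sub>R f x)))
     in integrable M (\<lambda>\<omega>. (norm (\<theta> (linearized_chain f S \<epsilon> h m0 \<xi> (l0 \<epsilon>) k \<omega>)))\<^sup>2)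
      \<and> (\<integral>\<omega>. (norm (\<theta> (linearized_chain f S \<epsilon> h m0 \<xi> (l0 \<epsilon>) k \<omega>)))\<^sup>2 \<partial>M) \<le> C * \<epsilon>)"
proof -
  let ?m = "euler_mean f h m0 k"
  let ?l = "\<lambda>\<epsilon>. linearized_chain f S \<epsilon> h m0 \<xi> (l0 \<epsilon>) k"
  let ?\<theta> = "\<lambda>\<epsilon> x. matrix_inv (matrix_sqrt ((\<epsilon> * h) *\<^sub>R S)) *v (linearized_drift f h ?m x - (x + h *\<^sub>R f x))"
  obtain s0 where s0: "0 < s0" "\<And>x. s0 * (norm x)\<^sup>2 \<le> x \<bullet> (S *v x)" by (rule pos_def_coercive[OF S]) blast
  obtain D s where D: "0 < D"
    "\<And>x. norm (f x - f ?m - jacobian f (at ?m) *v (x - ?m)) \<le> D * (1 + norm (x - ?m) ^ s) * (norm (x - ?m))\<^sup>2"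
    by (rule second_order_taylor[OF f, of ?m]) blast
  obtain C1 where C1: "0 \<le> C1" "\<forall>\<epsilon>>0. integrable M (\<lambda>\<omega>. norm (?l \<epsilon> \<omega> - ?m) ^ 4)
    \<and> (\<integral>\<omega>. norm (?l \<epsilon> \<omega> - ?m) ^ 4 \<partial>M) \<le> C1 * sqrt \<epsilon> ^ 4"
    using linearized_chain_moments[of k 4] by (elim exE conjE) (rule that)
  obtain C2 where C2: "0 \<le> C2" "\<forall>\<epsilon>>0. integrable M (\<lambda>\<omega>. norm (?l \<epsilon> \<omega> - ?m) ^ (4 + 2 * s))
    \<and> (\<integral>\<omega>. norm (?l \<epsilon> \<omega> - ?m) ^ (4 + 2 * s) \<partial>M) \<le> C2 * sqrt \<epsilon> ^ (4 + 2 * s)"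
    using linearized_chain_moments[of k "4 + 2 * s"] by (elim exE conjE) (rule that)
  \<comment> \<open>Combines the factor 2 from \<open>(1 + y)^2 \<le> 2 * (1 + y^2)\<close>, the
    squared Taylor constant with \<open>h^2\<close>, and the division by
    \<open>\<epsilon> * h * s0\<close>; the remaining \<open>1 / \<epsilon>\<close> is kept
    apart.\<close>
  define E where "E = 2 * h * D\<^sup>2 / s0"
  have E: "0 \<le> E" using h s0 by (simp add: E_def)
  have bd: "(norm (?\<theta> \<epsilon> x))\<^sup>2 \<le> E / \<epsilon> * (norm (x - ?m) ^ 4 + norm (x - ?m) ^ (4 + 2 * s))" if \<epsilon>: "0 < \<epsilon>" for \<epsilon> x
  proof -
    define u where "u = norm (x - ?m)"
    let ?R = "matrix_sqrt ((\<epsilon> * h) *\<^sub>R S)"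
    have pd: "pos_def ((\<epsilon> * h) *\<^sub>R S)" using S \<epsilon> h by (intro pos_def_scaleR) auto
    have "?R *v ?\<theta> \<epsilon> x = linearized_drift f h ?m x - (x + h *\<^sub>R f x)" by (rule matrix_sqrt_inverse[OF pd])
    also have "\<dots> = - (h *\<^sub>R (f x - f ?m - jacobian f (at ?m) *v (x - ?m)))"
      by (simp add: linearized_drift_def algebra_simps)
    finally have n\<theta>: "norm (?R *v ?\<theta> \<epsilon> x) = h * norm (f x - f ?m - jacobian f (at ?m) *v (x - ?m))"
      using h by simp
    \<comment> \<open>Coercivity of \<open>S\<close> bounds \<open>\<theta>\<close> from the norm of
      its image under the root, so no norm of the inverse matrix has to be estimated.\<close>
    have "\<epsilon> * h * (s0 * (norm (?\<theta> \<epsilon> x))\<^sup>2) \<le> \<epsilon> * h * (?\<theta> \<epsilon> x \<bullet> (S *v ?\<theta> \<epsilon> x))"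
      using \<epsilon> h by (intro mult_left_mono s0(2)) auto
    also have "\<dots> = (norm (?R *v ?\<theta> \<epsilon> x))\<^sup>2"
      using norm_matrix_sqrt[OF pos_def_imp_pos_semidef[OF pd]]
      by (simp add: scaleR_matrix_vector_assoc[symmetric])
    also have "\<dots> = (h * norm (f x - f ?m - jacobian f (at ?m) *v (x - ?m)))\<^sup>2"
      by (simp only: n\<theta>)
    also have "\<dots> \<le> (h * (D * (1 + u ^ s) * u\<^sup>2))\<^sup>2"
      unfolding u_def using h by (intro power_mono mult_left_mono D(2)) auto
    also have "\<dots> = h\<^sup>2 * D\<^sup>2 * ((1 + u ^ s)\<^sup>2 * u ^ 4)"
      by (simp add: power_mult_distrib power_mult[symmetric])
    also have "\<dots> \<le> h\<^sup>2 * D\<^sup>2 * ((2 * (1 + (u ^ s)\<^sup>2)) * u ^ 4)"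
    proof -
      have "(1 + u ^ s)\<^sup>2 \<le> 2 * (1 + (u ^ s)\<^sup>2)"
        using zero_le_power2[of "1 - u ^ s"] by (simp add: power2_eq_square algebra_simps)
      then show ?thesis by (intro mult_left_mono mult_right_mono) auto
    qed
    also have "\<dots> = 2 * h\<^sup>2 * D\<^sup>2 * (u ^ 4 + u ^ (4 + 2 * s))"
      by (simp add: power_add power_mult mult.commute[of 2 s] algebra_simps)
    finally have "(norm (?\<theta> \<epsilon> x))\<^sup>2 \<le> 2 * h\<^sup>2 * D\<^sup>2 * (u ^ 4 + u ^ (4 + 2 * s)) / (\<epsilon> * h * s0)"
      using \<epsilon> h s0(1) by (simp add: pos_le_divide_eq mult_ac)
    also have "\<dots> = E / \<epsilon> * (u ^ 4 + u ^ (4 + 2 * s))"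
    proof -
      have "2 * h\<^sup>2 * D\<^sup>2 * Z / (\<epsilon> * h * s0) = E / \<epsilon> * Z" for Z
        using h s0 \<epsilon> by (simp add: E_def power2_eq_square mult_ac)
      then show ?thesis .
    qed
    finally show ?thesis by (simp add: u_def)
  qed
  show ?thesis
    unfolding Let_def
  proof (intro exI conjI allI impI; (elim conjE)?)
    show "0 \<le> E * (C1 + C2)" using E C1(1) C2(1) by simp
    fix \<epsilon> :: real assume \<epsilon>: "0 < \<epsilon>" "\<epsilon> < 1"
    interpret L: gaussian_chain M \<xi> "linearized_chain f S \<epsilon> h m0 \<xi> (l0 \<epsilon>)"
      "\<lambda>k. linearized_drift f h (euler_mean f h m0 k)" "matrix_sqrt ((\<epsilon> * h) *\<^sub>R S)" by (rule chain[OF \<epsilon>(1)])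
    have "f \<in> borel_measurable borel"
      by (rule borel_measurable_continuous_onI[OF standing_assumption_continuous[OF f]])
    moreover have "(\<lambda>x. A *v x) \<in> borel_measurable borel" for A :: "real^'n^'n"
      by (intro borel_measurable_continuous_onI continuous_intros)
    ultimately have \<theta>m: "?\<theta> \<epsilon> \<in> borel_measurable borel"
      unfolding linearized_drift_def by measurable
    note C1\<epsilon> = C1(2)[rule_format, OF \<epsilon>(1)] and C2\<epsilon> = C2(2)[rule_format, OF \<epsilon>(1)]
    let ?B = "\<lambda>\<omega>. E / \<epsilon> * (norm (?l \<epsilon> \<omega> - ?m) ^ 4 + norm (?l \<epsilon> \<omega> - ?m) ^ (4 + 2 * s))"
    have iB: "integrable M ?B"
      by (intro integrable_mult_right Bochner_Integration.integrable_add C1\<epsilon>[THEN conjunct1] C2\<epsilon>[THEN conjunct1])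
    have "(\<lambda>\<omega>. ?\<theta> \<epsilon> (?l \<epsilon> \<omega>)) \<in> borel_measurable M"
      by (rule measurable_compose[OF L.X_measurable \<theta>m])
    then have m: "(\<lambda>\<omega>. (norm (?\<theta> \<epsilon> (?l \<epsilon> \<omega>)))\<^sup>2) \<in> borel_measurable M" by measurable
    show i\<theta>: "integrable M (\<lambda>\<omega>. (norm (?\<theta> \<epsilon> (?l \<epsilon> \<omega>)))\<^sup>2)"
    proof (rule Bochner_Integration.integrable_bound[OF iB m], rule AE_I2)
      show "norm ((norm (?\<theta> \<epsilon> (?l \<epsilon> \<omega>)))\<^sup>2) \<le> norm (?B \<omega>)" for \<omega>
        using order_trans[OF bd[OF \<epsilon>(1), of "?l \<epsilon> \<omega>"] abs_ge_self] by (simp only: real_norm_def abs_power2)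
    qed
    have "(\<integral>\<omega>. (norm (?\<theta> \<epsilon> (?l \<epsilon> \<omega>)))\<^sup>2 \<partial>M) \<le> (\<integral>\<omega>. ?B \<omega> \<partial>M)"
      by (rule integral_mono[OF i\<theta> iB bd[OF \<epsilon>(1)]])
    also have "\<dots> = E / \<epsilon> * ((\<integral>\<omega>. norm (?l \<epsilon> \<omega> - ?m) ^ 4 \<partial>M) + (\<integral>\<omega>. norm (?l \<epsilon> \<omega> - ?m) ^ (4 + 2 * s) \<partial>M))"
      using C1\<epsilon>[THEN conjunct1] C2\<epsilon>[THEN conjunct1] by simp
    also have "\<dots> \<le> E / \<epsilon> * (C1 * sqrt \<epsilon> ^ 4 + C2 * sqrt \<epsilon> ^ 4)"
    proof -
      \<comment> \<open>Here \<open>\<epsilon> < 1\<close> matters: the higher moment is absorbed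
        into the fourth-order rate.\<close>
      have "C2 * sqrt \<epsilon> ^ (4 + 2 * s) \<le> C2 * sqrt \<epsilon> ^ 4"
        using \<epsilon> C2(1) by (intro mult_left_mono power_decreasing) auto
      then have le: "(\<integral>\<omega>. norm (?l \<epsilon> \<omega> - ?m) ^ (4 + 2 * s) \<partial>M) \<le> C2 * sqrt \<epsilon> ^ 4"
        by (rule order_trans[OF C2\<epsilon>[THEN conjunct2]])
      show ?thesis
        by (rule mult_left_mono[OF add_mono[OF C1\<epsilon>[THEN conjunct2] le]]) (use E \<epsilon> in simp)
    qed
    also have "sqrt \<epsilon> ^ 4 = \<epsilon>\<^sup>2"
      using \<epsilon> power_mult[of "sqrt \<epsilon>" 2 2] by simp
    also have "E / \<epsilon> * (C1 * \<epsilon>\<^sup>2 + C2 * \<epsilon>\<^sup>2) = E * (C1 + C2) * \<epsilon>"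
      using \<epsilon> by (simp add: power2_eq_square distrib_left distrib_right mult_ac)
    finally show "(\<integral>\<omega>. (norm (?\<theta> \<epsilon> (?l \<epsilon> \<omega>)))\<^sup>2 \<partial>M) \<le> E * (C1 + C2) * \<epsilon>" .
  qed
qed

end

section \<open>A single constant for all steps up to the time horizon\<close>

theorem theorem4p2:
  fixes f :: "real ^ 'n \<Rightarrow> real ^ 'n"
    and T :: real
    and S C0 :: "real ^ 'n ^ 'n"
    and m0 :: "real ^ 'n"
    and \<mu>0 :: "real \<Rightarrow> (real ^ 'n) measure"
    and M :: "'w measure"
    and \<xi> :: "nat \<Rightarrow> 'w \<Rightarrow> real ^ 'n"
    and v0 l0 :: "real \<Rightarrow> 'w \<Rightarrow> real ^ 'n"
  assumes "T > 0"
    and "standing_assumption f T"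
    and "pos_def S"
    and "pos_semidef C0"
    and "\<And>\<epsilon>. \<epsilon> > 0 \<Longrightarrow> prob_space (\<mu>0 \<epsilon>) \<and> sets (\<mu>0 \<epsilon>) = sets borel"
    and "prob_space M"
    and "\<And>k. distr M borel (\<xi> k) = std_gaussian"
    and "\<And>\<epsilon>. \<epsilon> > 0 \<Longrightarrow> distr M borel (v0 \<epsilon>) = \<mu>0 \<epsilon>"
    and "\<And>\<epsilon>. \<epsilon> > 0 \<Longrightarrow> distr M borel (l0 \<epsilon>) = gaussian m0 (\<epsilon> *\<^sub>R C0)"
    and "\<And>\<epsilon>. \<epsilon> > 0 \<Longrightarrow> prob_space.indep_vars M (\<lambda>_. borel) (case_nat (v0 \<epsilon>) \<xi>) UNIV"
    and "\<And>\<epsilon>. \<epsilon> > 0 \<Longrightarrow> prob_space.indep_vars M (\<lambda>_. borel) (case_nat (l0 \<epsilon>) \<xi>) UNIV"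
  shows "\<forall>\<^sub>F h in at_right 0. \<exists>c>0. \<forall>\<^sub>F \<epsilon> in at_right 0. \<forall>k::nat. real k * h < T \<longrightarrow>
    (let v = nonlinear_chain f S \<epsilon> h \<xi> (v0 \<epsilon>);
         l = linearized_chain f S \<epsilon> h m0 \<xi> (l0 \<epsilon>);
         \<nu>0 = gaussian m0 (\<epsilon> *\<^sub>R C0)
     in KL (path_law M l k) (path_law M v k) \<le> KL \<nu>0 (\<mu>0 \<epsilon>) + ereal (c * \<epsilon>) \<and>
        KL (distr M borel (l k)) (distr M borel (v k)) \<le> KL \<nu>0 (\<mu>0 \<epsilon>) + ereal (c * \<epsilon>))"
proof (rule eventually_at_right_less[THEN eventually_mono])
  fix h :: real assume h: "0 < h"
  have f[measurable]: "f \<in> borel_measurable borel"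
    by (rule borel_measurable_continuous_onI[OF standing_assumption_continuous[OF assms(2)]])
  have mv[measurable]: "(\<lambda>x. A *v x) \<in> borel_measurable borel" for A :: "real^'n^'n"
    by (intro borel_measurable_continuous_onI continuous_intros)
  let ?R = "\<lambda>\<epsilon>. matrix_sqrt ((\<epsilon> * h) *\<^sub>R S)"
  let ?a = "\<lambda>k :: nat. \<lambda>x. x + h *\<^sub>R f x"
  let ?b = "\<lambda>k. linearized_drift f h (euler_mean f h m0 k)"
  have [measurable]: "?b k \<in> borel_measurable borel" for k
    unfolding linearized_drift_def by measurable
  have chain_v: "gaussian_chain M \<xi> (nonlinear_chain f S \<epsilon> h \<xi> (v0 \<epsilon>)) ?a (?R \<epsilon>)" if "0 < \<epsilon>" for \<epsilon>
    using assms(6,7) assms(10)[OF that]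
    by (auto simp: gaussian_chain_def gaussian_chain_axioms_def Let_def)
  have chain_l: "gaussian_chain M \<xi> (linearized_chain f S \<epsilon> h m0 \<xi> (l0 \<epsilon>)) ?b (?R \<epsilon>)" if "0 < \<epsilon>" for \<epsilon>
    using assms(6,7) assms(11)[OF that]
    by (auto simp: gaussian_chain_def gaussian_chain_axioms_def Let_def linearized_drift_def[of f h])
  let ?\<theta> = "\<lambda>\<epsilon> k x. matrix_inv (?R \<epsilon>) *v (?b k x - ?a k x)"
  let ?l = "\<lambda>\<epsilon>. linearized_chain f S \<epsilon> h m0 \<xi> (l0 \<epsilon>)"
  let ?v = "\<lambda>\<epsilon>. nonlinear_chain f S \<epsilon> h \<xi> (v0 \<epsilon>)"
  have "\<forall>k. \<exists>C\<ge>0. \<forall>\<epsilon>. 0 < \<epsilon> \<and> \<epsilon> < 1 \<longrightarrow> integrable M (\<lambda>\<omega>. (norm (?\<theta> \<epsilon> k (?l \<epsilon> k \<omega>)))\<^sup>2)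
      \<and> (\<integral>\<omega>. (norm (?\<theta> \<epsilon> k (?l \<epsilon> k \<omega>)))\<^sup>2 \<partial>M) \<le> C * \<epsilon>"
    using drift_difference_cost[OF assms(2-4) h assms(9) chain_l] by (simp only: Let_def simp_thms)
  \<comment> \<open>The constants are selected for every step index before \<open>\<epsilon>\<close>
    is fixed.\<close>
  from choice[OF this] obtain C where C: "\<And>k. 0 \<le> C k"
    "\<And>k \<epsilon>. 0 < \<epsilon> \<Longrightarrow> \<epsilon> < 1 \<Longrightarrow> integrable M (\<lambda>\<omega>. (norm (?\<theta> \<epsilon> k (?l \<epsilon> k \<omega>)))\<^sup>2)"
    "\<And>k \<epsilon>. 0 < \<epsilon> \<Longrightarrow> \<epsilon> < 1 \<Longrightarrow> (\<integral>\<omega>. (norm (?\<theta> \<epsilon> k (?l \<epsilon> k \<omega>)))\<^sup>2 \<partial>M) \<le> C k * \<epsilon>"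
    by blast
  \<comment> \<open>Every admissible \<open>k\<close> satisfies \<open>k \<le> N\<close>, so the sum
    of nonnegative step constants up to \<open>N\<close> dominates each partial sum.\<close>
  define N where "N = nat \<lceil>T / h\<rceil>"
  \<comment> \<open>The summand 1 guarantees \<open>c > 0\<close>; the factor 1/2 in each step cost
    is simply discarded.\<close>
  define c where "c = 1 + (\<Sum>k<N. C k)"
  have c: "0 < c" unfolding c_def using C(1) by (intro add_pos_nonneg sum_nonneg) auto
  have bound: "KL (path_law M (?l \<epsilon>) k) (path_law M (?v \<epsilon>) k) \<le> KL (gaussian m0 (\<epsilon> *\<^sub>R C0)) (\<mu>0 \<epsilon>) + ereal (c * \<epsilon>)
      \<and> KL (distr M borel (?l \<epsilon> k)) (distr M borel (?v \<epsilon> k)) \<le> KL (gaussian m0 (\<epsilon> *\<^sub>R C0)) (\<mu>0 \<epsilon>) + ereal (c * \<epsilon>)"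
    if \<epsilon>: "0 < \<epsilon>" "\<epsilon> < 1" and k: "real k * h < T" for \<epsilon> k
  proof -
    interpret L: gaussian_chain M \<xi> "?l \<epsilon>" ?b "?R \<epsilon>" by (rule chain_l[OF \<epsilon>(1)])
    interpret V: gaussian_chain M \<xi> "?v \<epsilon>" ?a "?R \<epsilon>" by (rule chain_v[OF \<epsilon>(1)])
    have \<nu>0: "gaussian m0 (\<epsilon> *\<^sub>R C0) = distr M borel (?l \<epsilon> 0)" using assms(9)[OF \<epsilon>(1)] by simp
    have \<mu>0: "\<mu>0 \<epsilon> = distr M borel (?v \<epsilon> 0)" using assms(8)[OF \<epsilon>(1)] by simp
    have PQ: "prob_space (distr M borel (?v \<epsilon> j))" "prob_space (distr M borel (?l \<epsilon> j))" for j
      by (intro L.prob_space_distr L.X_measurable V.X_measurable)+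
    let ?K = "KL (gaussian m0 (\<epsilon> *\<^sub>R C0)) (\<mu>0 \<epsilon>)"
    show ?thesis
    \<comment> \<open>Only a finite initial divergence has content: for plus infinity both
      right-hand sides are infinite, and minus infinity contradicts nonnegativity.\<close>
    proof (cases ?K)
      case (real B)
      have init: "relative_entropy_le (distr M borel (?l \<epsilon> 0)) (distr M borel (?v \<epsilon> 0)) B"
        by (rule relative_entropy_le_of_KL_le[OF PQ]) (use real in \<open>simp_all add: \<nu>0 \<mu>0 del: linearized_chain.simps nonlinear_chain.simps\<close>)
      have pd: "pos_def ((\<epsilon> * h) *\<^sub>R S)" using assms(3) \<epsilon> h by (intro pos_def_scaleR) auto
      have le0: "relative_entropy_le (path_law M (?l \<epsilon>) k) (path_law M (?v \<epsilon>) k)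
          (B + (\<Sum>j<k. (\<integral>\<omega>. (norm (?\<theta> \<epsilon> j (?l \<epsilon> j \<omega>)))\<^sup>2 \<partial>M) / 2))"
        by (rule relative_entropy_le_path_law[OF chain_v[OF \<epsilon>(1)] chain_l[OF \<epsilon>(1)] init _ matrix_sqrt_inverse[OF pd] C(2)[OF \<epsilon>]]) measurable
      have sum_le: "(\<Sum>j<k. (\<integral>\<omega>. (norm (?\<theta> \<epsilon> j (?l \<epsilon> j \<omega>)))\<^sup>2 \<partial>M) / 2) \<le> c * \<epsilon>"
      proof -
        have kN: "k \<le> N"
        proof -
          have "real k \<le> T / h" using k h by (simp add: pos_le_divide_eq)
          then show ?thesis unfolding N_def by linarith
        qed
        have "(\<Sum>j<k. (\<integral>\<omega>. (norm (?\<theta> \<epsilon> j (?l \<epsilon> j \<omega>)))\<^sup>2 \<partial>M) / 2) \<le> (\<Sum>j<k. C j * \<epsilon>)"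
        proof (rule sum_mono)
          fix j
          have "0 \<le> (\<integral>\<omega>. (norm (?\<theta> \<epsilon> j (?l \<epsilon> j \<omega>)))\<^sup>2 \<partial>M)" by simp
          with C(3)[OF \<epsilon>, of j] show "(\<integral>\<omega>. (norm (?\<theta> \<epsilon> j (?l \<epsilon> j \<omega>)))\<^sup>2 \<partial>M) / 2 \<le> C j * \<epsilon>" by linarith
        qed
        also have "\<dots> \<le> (\<Sum>j<N. C j * \<epsilon>)" using kN C(1) \<epsilon> by (intro sum_mono2) auto
        also have "\<dots> \<le> c * \<epsilon>" using \<epsilon> by (simp add: c_def sum_distrib_right distrib_right)
        finally show ?thesis .
      qed
      have le: "relative_entropy_le (path_law M (?l \<epsilon>) k) (path_law M (?v \<epsilon>) k) (B + c * \<epsilon>)"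
        by (rule relative_entropy_le_mono[OF le0 add_left_mono[OF sum_le]])
      have sets: "sets (path_law M (?l \<epsilon>) k) = sets (path_law M (?v \<epsilon>) k)"
        by (simp add: L.sets_path_law V.sets_path_law)
      have "KL (path_law M (?l \<epsilon>) k) (path_law M (?v \<epsilon>) k) \<le> ereal (B + c * \<epsilon>)"
        by (rule KL_le_of_relative_entropy_le[OF V.prob_space_path_law L.prob_space_path_law sets le])
      \<comment> \<open>The marginal bound is the path bound pushed through evaluation at
        \<open>k\<close>, with the same constant.\<close>
      moreover have "KL (distr M borel (?l \<epsilon> k)) (distr M borel (?v \<epsilon> k)) \<le> ereal (B + c * \<epsilon>)"
      proof (rule KL_le_of_relative_entropy_le[OF PQ])
        have "(\<lambda>x. x k) \<in> borel_measurable (path_law M (?v \<epsilon>) k)"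
          unfolding measurable_cong_sets[OF V.sets_path_law refl] by (rule measurable_component_singleton) simp
        then show "relative_entropy_le (distr M borel (?l \<epsilon> k)) (distr M borel (?v \<epsilon> k)) (B + c * \<epsilon>)"
          unfolding L.distr_X_eq[of k] V.distr_X_eq[of k] by (rule relative_entropy_le_distr[OF le sets])
      qed simp
      ultimately show ?thesis using real by simp
    next
      case MInf
      have "0 \<le> ?K"
        unfolding \<nu>0 \<mu>0 by (rule KL_nonneg[OF PQ]) simp
      with MInf show ?thesis by simp
    qed simp
  qed
  show "\<exists>c>0. \<forall>\<^sub>F \<epsilon> in at_right 0. \<forall>k::nat. real k * h < T \<longrightarrow>
    (let v = nonlinear_chain f S \<epsilon> h \<xi> (v0 \<epsilon>);
         l = linearized_chain f S \<epsilon> h m0 \<xi> (l0 \<epsilon>);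
         \<nu>0 = gaussian m0 (\<epsilon> *\<^sub>R C0)
     in KL (path_law M l k) (path_law M v k) \<le> KL \<nu>0 (\<mu>0 \<epsilon>) + ereal (c * \<epsilon>) \<and>
        KL (distr M borel (l k)) (distr M borel (v k)) \<le> KL \<nu>0 (\<mu>0 \<epsilon>) + ereal (c * \<epsilon>))"
    unfolding Let_def eventually_at_right_field
    by (intro exI[of _ c] conjI c exI[of _ 1] allI impI bound) auto
qed

end
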